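(* Let $g(t)=\sum_{k=1}^N\frac{a_k}{t-iw_k}$ with $a_k,w_k\in\mathbb{C}$, $a_k\neq0$, $\Re w_k\neq0$, and let $\alpha\in(0,1]$. For $k=1,\dots,N$ and $s=0,\dots,N-1$ set $$A_{k,s}=(-1)^s\sum_{\substack{j_1<j_2<\dots<j_s\\ j_l\neq k}} e^{\frac{2\pi}{\alpha}(w_{j_1}+\dots+w_{j_s})}$$ (the sum over $s$-element subsets of $\{1,\dots,N\}\setminus\{k\}$; $A_{k,0}=1$), and $$m_s(\xi)=\sum_{k=1}^N a_kA_{k,s}e^{2\pi\xi w_k}.$$ Then the following are equivalent: (1) $\mathcal{G}(g;\alpha,1)$ is a frame in $L^2(\mathbb{R})$; (2) there exist constants $0<c\le C<\infty$ such that for all $G\in L^2(\mathbb{R})$ $$c\|G\|^2_{L^2(\mathbb{R})}\le\int_0^{1/\alpha}\sum_{n\in\mathbb{Z}}\Big|\sum_{s=0}^{N-1}G\Big(\xi+n+\frac{s}{\alpha}\Big)m_s(\xi)\Big|^2d\xi\le C\|G\|^2_{L^2(\mathbb{R})}.$$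
   Context: $\mathcal{G}(g;\alpha,1)=\{e^{2\pi i n t}g(t-\alpha m)\}_{m,n\in\mathbb{Z}}$; it is a frame in $L^2(\mathbb{R})$ if there are $0<A\le B<\infty$ with $A\|f\|^2\le\sum_{m,n}|\langle f, e^{2\pi i n\cdot}g(\cdot-\alpha m)\rangle|^2\le B\|f\|^2$ for all $f\in L^2(\mathbb{R})$. *)

theory Defs
  imports "HOL-Analysis.Analysis"
begin

definition L2_fun :: "(real \<Rightarrow> complex) \<Rightarrow> bool" where
  "L2_fun f \<longleftrightarrow> f \<in> borel_measurable lborel \<and> integrable lborel (\<lambda>x. (cmod (f x))\<^sup>2)"

definition L2_norm_sq :: "(real \<Rightarrow> complex) \<Rightarrow> real" where
  "L2_norm_sq f = (LINT x|lborel. (cmod (f x))\<^sup>2)"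

definition L2_inner :: "(real \<Rightarrow> complex) \<Rightarrow> (real \<Rightarrow> complex) \<Rightarrow> complex" where
  "L2_inner f h = (LINT x|lborel. f x * cnj (h x))"

definition gabor_atom :: "(real \<Rightarrow> complex) \<Rightarrow> real \<Rightarrow> int \<Rightarrow> int \<Rightarrow> real \<Rightarrow> complex" where
  "gabor_atom g \<alpha> m n t = exp (2 * pi * \<i> * of_int n * of_real t) * g (t - \<alpha> * of_int m)"

text \<open>G(g; alpha, 1) is a frame in L^2(R). The (possibly infinite) sum of squares is
  taken in the extended nonnegative reals, so the upper bound includes convergence.\<close>
definition gabor_frame :: "(real \<Rightarrow> complex) \<Rightarrow> real \<Rightarrow> bool" where
  "gabor_frame g \<alpha> \<longleftrightarrow>
     (\<exists>A B. 0 < A \<and> A \<le> B \<and>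
        (\<forall>f. L2_fun f \<longrightarrow>
           ennreal (A * L2_norm_sq f)
             \<le> (\<Sum>\<^sub>\<infinity>mn\<in>(UNIV :: (int \<times> int) set).
                   ennreal ((cmod (L2_inner f (gabor_atom g \<alpha> (fst mn) (snd mn))))\<^sup>2)) \<and>
           (\<Sum>\<^sub>\<infinity>mn\<in>(UNIV :: (int \<times> int) set).
                   ennreal ((cmod (L2_inner f (gabor_atom g \<alpha> (fst mn) (snd mn))))\<^sup>2))
             \<le> ennreal (B * L2_norm_sq f)))"

definition A_coef :: "nat \<Rightarrow> (nat \<Rightarrow> complex) \<Rightarrow> real \<Rightarrow> nat \<Rightarrow> nat \<Rightarrow> complex" where
  "A_coef N w \<alpha> k s = (-1) ^ s *
     (\<Sum>J\<in>{J. J \<subseteq> {1..N} - {k} \<and> card J = s}.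
        exp (of_real (2 * pi / \<alpha>) * (\<Sum>j\<in>J. w j)))"

definition m_fun :: "nat \<Rightarrow> (nat \<Rightarrow> complex) \<Rightarrow> (nat \<Rightarrow> complex) \<Rightarrow> real \<Rightarrow> nat \<Rightarrow> real \<Rightarrow> complex" where
  "m_fun N a w \<alpha> s \<xi> = (\<Sum>k=1..N. a k * A_coef N w \<alpha> k s * exp (of_real (2 * pi * \<xi>) * w k))"

end

theory Submission
  imports Defs
begin

text \<open>
  Let \<open>T\<close> be the translation by \<open>1/\<alpha>\<close> and \<open>z\<^sub>k = exp (2 \<pi> w\<^sub>k / \<alpha>)\<close>. The Fourier transform of
  \<open>1/(t - \<i> w\<^sub>k)\<close> is an exponential on a half-line, and summing it over the lattice \<open>x + \<int>/\<alpha>\<close>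
  against a function \<open>F\<close> amounts, for either sign of \<open>Re w\<^sub>k\<close>, to applying a multiple of the inverse
  of \<open>1 - z\<^sub>k T\<close>. Substituting \<open>F = (1 - z\<^sub>1 T) \<dots> (1 - z\<^sub>N T) G\<close> therefore turns the coefficient of the
  conjugate of \<open>F\<close> (transformed back) with respect to the atom \<open>(m, n)\<close> into the \<open>m\<close>-th Fourier
  coefficient on \<open>[0, 1/\<alpha>]\<close> of \<open>\<Sum>\<^sub>s G(x + n + s/\<alpha>) m\<^sub>s(x)\<close>, and Parseval identifies the two
  quadratic forms up to a constant. As \<open>|z\<^sub>k| \<noteq> 1\<close>, the substitution is bounded above and below with
  dense range, which suffices. Plancherel is obtained from Parseval by sampling.
\<close>

section \<open>The semi-inner product on square-integrable functions\<close>

text \<open>The coefficients \<open>A_coef\<close> arise because the transform of the window is a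
  sum over k, and the kernel of the k-th summand absorbs only its own factor of the product. The
  product of the other factors survives, and expanding it over subsets of the remaining indices
  gives \<open>A_coef\<close>. The obstacle is that the Fourier transform is available only as an
  absolutely convergent integral, so the two quadratic forms are compared only for G that is both
  integrable and square-integrable, and each inequality must still be carried over to all of L2. An
  upper bound survives a limit, through finite subsums or through Fatou's lemma. A lower bound does
  not do so by itself; it is transferred with the help of the upper one at the price of a factor 8,
  which is harmless because only the existence of constants is claimed. Functions are never
  identified modulo null sets, so \<open>L2_norm_sq\<close> is the square of a seminorm, and L2
  convergence is expressed by the squared seminorm of a difference.\<close>

lemma L2_fun_measurable [measurable_dest]: "L2_fun f \<Longrightarrow> f \<in> borel_measurable borel"
  by (simp add: L2_fun_def)

lemma L2_fun_integrable: "L2_fun f \<Longrightarrow> integrable lborel (\<lambda>x. (cmod (f x))\<^sup>2)"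
  by (simp add: L2_fun_def)

lemma L2_funI:
  "f \<in> borel_measurable borel \<Longrightarrow> integrable lborel (\<lambda>x. (cmod (f x))\<^sup>2) \<Longrightarrow> L2_fun f"
  by (simp add: L2_fun_def)

lemma L2_fun_bound:
  assumes "L2_fun h" "f \<in> borel_measurable borel" "\<And>x. cmod (f x) \<le> C * cmod (h x)"
  shows "L2_fun f"
proof (rule L2_funI[OF assms(2)])
  have "integrable lborel (\<lambda>x. C\<^sup>2 * (cmod (h x))\<^sup>2)"
    using L2_fun_integrable[OF assms(1)] by simp
  then show "integrable lborel (\<lambda>x. (cmod (f x))\<^sup>2)"
  proof (rule Bochner_Integration.integrable_bound)
    show "AE x in lborel. norm ((cmod (f x))\<^sup>2) \<le> norm (C\<^sup>2 * (cmod (h x))\<^sup>2)"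
      using power_mono[OF assms(3) norm_ge_zero, of _ 2] by (auto simp: power_mult_distrib)
  qed (use assms(2) in simp)
qed

lemma L2_fun_zero [simp]: "L2_fun (\<lambda>x. 0)"
  by (simp add: L2_fun_def)

lemma cmod_add_sq_le: "(cmod (a + b))\<^sup>2 \<le> 2 * (cmod a)\<^sup>2 + 2 * (cmod b)\<^sup>2"
proof -
  have "(cmod (a + b))\<^sup>2 \<le> (cmod a + cmod b)\<^sup>2"
    by (simp add: norm_triangle_ineq power_mono)
  also have "\<dots> \<le> 2 * (cmod a)\<^sup>2 + 2 * (cmod b)\<^sup>2"
    using zero_le_power2[of "cmod a - cmod b"] by (simp add: power2_sum power2_diff)
  finally show ?thesis .
qed

lemma L2_fun_add [intro]:
  assumes "L2_fun f" "L2_fun h" shows "L2_fun (\<lambda>x. f x + h x)"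
proof (rule L2_funI)
  have [measurable]: "f \<in> borel_measurable borel" "h \<in> borel_measurable borel"
    using assms by (auto dest: L2_fun_measurable)
  show "(\<lambda>x. f x + h x) \<in> borel_measurable borel" by measurable
  have "integrable lborel (\<lambda>x. 2 * (cmod (f x))\<^sup>2 + 2 * (cmod (h x))\<^sup>2)"
    using assms by (simp add: L2_fun_integrable)
  then show "integrable lborel (\<lambda>x. (cmod (f x + h x))\<^sup>2)"
    by (rule Bochner_Integration.integrable_bound) (use cmod_add_sq_le in auto)
qed

lemma L2_fun_cmult [intro]: "L2_fun f \<Longrightarrow> L2_fun (\<lambda>x. c * f x)"
  by (rule L2_fun_bound[of f _ "cmod c"]) (auto dest: L2_fun_measurable simp: norm_mult)

lemma L2_fun_minus [intro]: "L2_fun f \<Longrightarrow> L2_fun (\<lambda>x. - f x)"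
  using L2_fun_cmult[of f "-1"] by simp

lemma L2_fun_diff [intro]: "L2_fun f \<Longrightarrow> L2_fun h \<Longrightarrow> L2_fun (\<lambda>x. f x - h x)"
  using L2_fun_add[of f "\<lambda>x. - h x"] by auto

lemma borel_measurable_cnj [measurable (raw)]:
  "f \<in> borel_measurable M \<Longrightarrow> (\<lambda>x. cnj (f x)) \<in> borel_measurable M"
  by (rule borel_measurable_continuous_on[where f = cnj]) (auto intro: continuous_intros)

lemma L2_fun_cnj [intro]: "L2_fun f \<Longrightarrow> L2_fun (\<lambda>x. cnj (f x))"
  by (rule L2_fun_bound[of f _ 1]) (auto dest: L2_fun_measurable)

lemma L2_fun_sum [intro]: "(\<And>i. i \<in> I \<Longrightarrow> L2_fun (f i)) \<Longrightarrow> L2_fun (\<lambda>x. \<Sum>i\<in>I. f i x)"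
  by (induction I rule: infinite_finite_induct) auto

lemma L2_fun_mult_bounded:
  assumes "L2_fun f" and [measurable]: "h \<in> borel_measurable borel" and "\<And>x. cmod (h x) \<le> B"
  shows "L2_fun (\<lambda>x. h x * f x)"
proof (rule L2_fun_bound[OF assms(1)])
  have [measurable]: "f \<in> borel_measurable borel" using assms(1) by (rule L2_fun_measurable)
  show "(\<lambda>x. h x * f x) \<in> borel_measurable borel" by measurable
  show "cmod (h x * f x) \<le> B * cmod (f x)" for x
    unfolding norm_mult by (intro mult_right_mono assms(3)) simp
qed

lemma L2_fun_indicator_mult [intro]:
  "L2_fun f \<Longrightarrow> A \<in> sets borel \<Longrightarrow> L2_fun (\<lambda>x. indicator A x * f x)"
  by (rule L2_fun_mult_bounded[where B = 1]) (auto simp: indicator_def)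

lemma L2_fun_shift_iff: "L2_fun (\<lambda>x. f (x + c)) \<longleftrightarrow> L2_fun f"
proof -
  have *: "L2_fun (\<lambda>x. f (x + c))" if "L2_fun f" for f c
  proof (rule L2_funI)
    have [measurable]: "f \<in> borel_measurable borel" using that by (rule L2_fun_measurable)
    show "(\<lambda>x. f (x + c)) \<in> borel_measurable borel" by measurable
    show "integrable lborel (\<lambda>x. (cmod (f (x + c)))\<^sup>2)"
      using lborel_integrable_real_affine[OF L2_fun_integrable[OF that], of 1 c] by (simp add: add.commute)
  qed
  from *[of f c] *[of "\<lambda>x. f (x + c)" "-c"] show ?thesis by auto
qed

lemma L2_norm_sq_shift: "L2_norm_sq (\<lambda>x. f (x + c)) = L2_norm_sq f"
  unfolding L2_norm_sq_def
  using lborel_integral_real_affine[of 1 "\<lambda>x. (cmod (f x))\<^sup>2" c] by (simp add: add.commute)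

lemma L2_fun_mult_integrable:
  assumes "L2_fun f" "L2_fun h" shows "integrable lborel (\<lambda>x. f x * h x)"
proof -
  have "integrable lborel (\<lambda>x. (cmod (f x))\<^sup>2 + (cmod (h x))\<^sup>2)"
    using assms by (simp add: L2_fun_integrable)
  then show ?thesis
  proof (rule Bochner_Integration.integrable_bound)
    show "AE x in lborel. norm (f x * h x) \<le> norm ((cmod (f x))\<^sup>2 + (cmod (h x))\<^sup>2)"
    proof (rule AE_I2)
      fix x
      have "2 * (cmod (f x) * cmod (h x)) \<le> (cmod (f x))\<^sup>2 + (cmod (h x))\<^sup>2"
        using zero_le_power2[of "cmod (f x) - cmod (h x)"] by (simp add: power2_diff)
      moreover have "0 \<le> cmod (f x) * cmod (h x)" by simp
      ultimately show "norm (f x * h x) \<le> norm ((cmod (f x))\<^sup>2 + (cmod (h x))\<^sup>2)"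
        unfolding norm_mult by (simp only: real_norm_def abs_of_nonneg add_nonneg_nonneg zero_le_power2)
    qed
  qed (use assms in \<open>auto dest: L2_fun_measurable\<close>)
qed

lemma L2_inner_integrable: "L2_fun f \<Longrightarrow> L2_fun h \<Longrightarrow> integrable lborel (\<lambda>x. f x * cnj (h x))"
  by (intro L2_fun_mult_integrable L2_fun_cnj)

lemma L2_inner_commute: "L2_inner h f = cnj (L2_inner f h)"
proof -
  have "L2_inner h f = (LINT x|lborel. cnj (f x * cnj (h x)))"
    by (simp add: L2_inner_def mult.commute)
  also have "\<dots> = cnj (L2_inner f h)"
    unfolding L2_inner_def by (rule Bochner_Integration.integral_cnj)
  finally show ?thesis .
qed

lemma L2_inner_add_left:
  "L2_fun f \<Longrightarrow> L2_fun g \<Longrightarrow> L2_fun h \<Longrightarrow>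
    L2_inner (\<lambda>x. f x + g x) h = L2_inner f h + L2_inner g h"
  unfolding L2_inner_def by (simp add: distrib_right L2_inner_integrable)

lemma L2_inner_cmult_left: "L2_inner (\<lambda>x. c * f x) h = c * L2_inner f h"
  unfolding L2_inner_def by (simp add: mult.assoc)

lemma L2_inner_diff_left:
  "L2_fun f \<Longrightarrow> L2_fun g \<Longrightarrow> L2_fun h \<Longrightarrow>
    L2_inner (\<lambda>x. f x - g x) h = L2_inner f h - L2_inner g h"
  unfolding L2_inner_def by (simp add: left_diff_distrib L2_inner_integrable)

lemma L2_inner_zero_left [simp]: "L2_inner (\<lambda>x. 0) h = 0"
  by (simp add: L2_inner_def)

lemma L2_inner_sum_left:
  "(\<And>i. i \<in> I \<Longrightarrow> L2_fun (f i)) \<Longrightarrow> L2_fun h \<Longrightarrow>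
    L2_inner (\<lambda>x. \<Sum>i\<in>I. f i x) h = (\<Sum>i\<in>I. L2_inner (f i) h)"
proof (induction I rule: infinite_finite_induct)
  case (insert i I)
  then have "L2_inner (\<lambda>x. f i x + (\<Sum>i\<in>I. f i x)) h = L2_inner (f i) h + (\<Sum>i\<in>I. L2_inner (f i) h)"
    by (subst L2_inner_add_left) auto
  then show ?case using insert by simp
qed auto

lemma L2_inner_self: "L2_inner f f = of_real (L2_norm_sq f)"
  unfolding L2_inner_def L2_norm_sq_def
  by (simp flip: integral_complex_of_real complex_norm_square)

lemma L2_norm_sq_nonneg [simp]: "0 \<le> L2_norm_sq f"
  by (simp add: L2_norm_sq_def)

lemma L2_norm_sq_cmult: "L2_norm_sq (\<lambda>x. c * f x) = (cmod c)\<^sup>2 * L2_norm_sq f"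
  by (simp add: L2_norm_sq_def norm_mult power_mult_distrib)

lemma L2_norm_sq_minus_commute: "L2_norm_sq (\<lambda>x. f x - g x) = L2_norm_sq (\<lambda>x. g x - f x)"
  by (simp add: L2_norm_sq_def norm_minus_commute)

lemma L2_norm_sq_cnj: "L2_norm_sq (\<lambda>x. cnj (f x)) = L2_norm_sq f"
  by (simp add: L2_norm_sq_def)

lemma L2_norm_sq_add:
  assumes "L2_fun f" "L2_fun h"
  shows "L2_norm_sq (\<lambda>x. f x + h x) = L2_norm_sq f + 2 * Re (L2_inner f h) + L2_norm_sq h"
proof -
  note [simp] = L2_fun_integrable[OF assms(1)] L2_fun_integrable[OF assms(2)]
    L2_inner_integrable[OF assms]
  have *: "(cmod (f x + h x))\<^sup>2 = (cmod (f x))\<^sup>2 + 2 * Re (f x * cnj (h x)) + (cmod (h x))\<^sup>2" for x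
    unfolding cmod_power2 by (simp add: power2_eq_square algebra_simps)
  have "L2_norm_sq (\<lambda>x. f x + h x) = (LINT x|lborel. (cmod (f x))\<^sup>2)
      + 2 * (LINT x|lborel. Re (f x * cnj (h x))) + (LINT x|lborel. (cmod (h x))\<^sup>2)"
    unfolding L2_norm_sq_def * by (simp del: times_complex.sel)
  moreover have "(LINT x|lborel. Re (f x * cnj (h x))) = Re (L2_inner f h)"
    unfolding L2_inner_def by (rule integral_Re) simp
  ultimately show ?thesis by (simp add: L2_norm_sq_def)
qed

lemma L2_norm_sq_diff:
  assumes "L2_fun f" "L2_fun h"
  shows "L2_norm_sq (\<lambda>x. f x - h x) = L2_norm_sq f - 2 * Re (L2_inner f h) + L2_norm_sq h"
proof -
  have "L2_inner f (\<lambda>x. - h x) = - L2_inner f h"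
    by (simp add: L2_inner_def)
  moreover have "L2_norm_sq (\<lambda>x. - h x) = L2_norm_sq h" by (simp add: L2_norm_sq_def)
  ultimately show ?thesis
    using L2_norm_sq_add[OF assms(1) L2_fun_minus[OF assms(2)]] by simp
qed

text \<open>Working with squared norms, this replaces Minkowski's inequality. The factor 2 is why
  the two-step approximations below take each step to accuracy \<open>e / 4\<close>.\<close>

lemma L2_norm_sq_add_le:
  assumes "L2_fun f" "L2_fun h"
  shows "L2_norm_sq (\<lambda>x. f x + h x) \<le> 2 * L2_norm_sq f + 2 * L2_norm_sq h"
proof -
  have "L2_norm_sq (\<lambda>x. f x + h x) \<le> (LINT x|lborel. 2 * (cmod (f x))\<^sup>2 + 2 * (cmod (h x))\<^sup>2)"
    unfolding L2_norm_sq_def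
    using assms by (intro integral_mono) (auto intro!: cmod_add_sq_le L2_fun_integrable)
  also have "\<dots> = 2 * L2_norm_sq f + 2 * L2_norm_sq h"
    using assms by (simp add: L2_norm_sq_def L2_fun_integrable)
  finally show ?thesis .
qed

text \<open>The squared norm of \<open>f - t z h\<close>, with z the inner product, is a nonnegative
  quadratic in the real parameter t. Since \<open>H = 0\<close> does not make h vanish everywhere,
  the degenerate case needs its own choice of t.\<close>

lemma L2_Cauchy_Schwarz:
  assumes "L2_fun f" "L2_fun h"
  shows "(cmod (L2_inner f h))\<^sup>2 \<le> L2_norm_sq f * L2_norm_sq h"
proof -
  define z where "z = L2_inner f h"
  define F where "F = L2_norm_sq f"
  define H where "H = L2_norm_sq h"
  have quad: "0 \<le> F - 2 * t * (cmod z)\<^sup>2 + t\<^sup>2 * (cmod z)\<^sup>2 * H" for t :: real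
  proof -
    have "L2_inner f (\<lambda>x. (of_real t * z) * h x) = cnj (of_real t * z) * z"
      unfolding z_def by (subst L2_inner_commute, subst L2_inner_cmult_left) (simp flip: L2_inner_commute)
    also have "\<dots> = of_real (t * (cmod z)\<^sup>2)"
      by (simp add: complex_norm_square del: of_real_power)
    finally have *: "L2_inner f (\<lambda>x. (of_real t * z) * h x) = of_real (t * (cmod z)\<^sup>2)" .
    have "0 \<le> L2_norm_sq (\<lambda>x. f x - (of_real t * z) * h x)" by simp
    also have "\<dots> = F - 2 * (t * (cmod z)\<^sup>2) + (cmod (of_real t * z))\<^sup>2 * H"
      unfolding F_def H_def using assms
      by (subst L2_norm_sq_diff) (auto simp: * L2_norm_sq_cmult simp del: of_real_mult)
    finally show ?thesis by (simp add: norm_mult power_mult_distrib)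
  qed
  have "(cmod z)\<^sup>2 \<le> F * H"
  proof (cases "H = 0")
    case False
    then have "H > 0" using L2_norm_sq_nonneg[of h] unfolding H_def by linarith
    \<comment> \<open>The minimum of the quadratic is at \<open>t = 1 / H\<close>.\<close>
    then show ?thesis using quad[of "1 / H"] by (simp add: field_simps power2_eq_square)
  next
    case True
    have "cmod z = 0"
    proof (rule ccontr)
      assume "cmod z \<noteq> 0"
      \<comment> \<open>With \<open>H = 0\<close> the quadratic becomes linear in t, and this t
        gives it the value -1.\<close>
      then show False using quad[of "(F + 1) / (2 * (cmod z)\<^sup>2)"] True L2_norm_sq_nonneg[of f]
        unfolding F_def by (simp add: field_simps)
    qed
    then show ?thesis using True by simp
  qed
  then show ?thesis unfolding z_def F_def H_def .
qed

lemma L2_inner_tendsto: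
  assumes "\<And>k. L2_fun (f k)" "L2_fun f'" "L2_fun h"
    and "(\<lambda>k. L2_norm_sq (\<lambda>x. f k x - f' x)) \<longlonglongrightarrow> 0"
  shows "(\<lambda>k. L2_inner (f k) h) \<longlonglongrightarrow> L2_inner f' h"
proof -
  have "(\<lambda>k. (cmod (L2_inner (f k) h - L2_inner f' h))\<^sup>2) \<longlonglongrightarrow> 0"
  proof (rule tendsto_sandwich[OF _ _ tendsto_const tendsto_mult_left_zero])
    show "\<forall>\<^sub>F k in sequentially. (cmod (L2_inner (f k) h - L2_inner f' h))\<^sup>2
        \<le> L2_norm_sq (\<lambda>x. f k x - f' x) * L2_norm_sq h"
      using assms by (auto simp flip: L2_inner_diff_left intro!: always_eventually L2_Cauchy_Schwarz)
  qed (use assms in auto)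
  then have "(\<lambda>k. sqrt ((cmod (L2_inner (f k) h - L2_inner f' h))\<^sup>2)) \<longlonglongrightarrow> sqrt 0"
    by (rule tendsto_real_sqrt)
  then show ?thesis
    by (simp add: tendsto_norm_zero_iff LIM_zero_iff)
qed

text \<open>Expanding the square expresses the norm of \<open>f k\<close> by the norm of the
  difference and an inner product with the fixed f', and both of these converge.\<close>

lemma L2_norm_sq_tendsto:
  assumes "\<And>k. L2_fun (f k)" "L2_fun f'"
    and "(\<lambda>k. L2_norm_sq (\<lambda>x. f k x - f' x)) \<longlonglongrightarrow> 0"
  shows "(\<lambda>k. L2_norm_sq (f k)) \<longlonglongrightarrow> L2_norm_sq f'"
proof -
  have "(\<lambda>k. L2_norm_sq (\<lambda>x. f k x - f' x) + 2 * Re (L2_inner (f k) f') - L2_norm_sq f')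
      \<longlonglongrightarrow> 0 + 2 * Re (L2_inner f' f') - L2_norm_sq f'"
    by (intro tendsto_intros assms tendsto_Re L2_inner_tendsto)
  then show ?thesis
    using assms by (simp add: L2_norm_sq_diff L2_inner_self)
qed

text \<open>The error is dominated by the square of f itself. Truncations matter because a
  square-integrable function of bounded support is integrable, hence has an absolutely convergent
  Fourier integral.\<close>

lemma L2_truncation:
  assumes "L2_fun f"
  shows "(\<lambda>k. L2_norm_sq (\<lambda>x. indicator {- real k..real k} x * f x - f x)) \<longlonglongrightarrow> 0"
proof -
  have f [measurable]: "f \<in> borel_measurable borel" using assms by (rule L2_fun_measurable)
  define s where "s k x = (cmod (indicator {- real k..real k} x * f x - f x))\<^sup>2" for k x
  have "(\<lambda>k. integral\<^sup>L lborel (s k)) \<longlonglongrightarrow> integral\<^sup>L lborel (\<lambda>x::real. 0)"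
  proof (rule integral_dominated_convergence)
    show "s k \<in> borel_measurable lborel" for k
      unfolding s_def by measurable
    show "integrable lborel (\<lambda>x. (cmod (f x))\<^sup>2)" using assms by (rule L2_fun_integrable)
    show "AE x in lborel. norm (s k x) \<le> (cmod (f x))\<^sup>2" for k
      by (simp add: s_def indicator_def)
    show "AE x in lborel. (\<lambda>k. s k x) \<longlonglongrightarrow> 0"
    proof (rule AE_I2)
      fix x :: real
      obtain K :: nat where K: "\<bar>x\<bar> \<le> real K" using real_arch_simple by blast
      have "\<forall>\<^sub>F k in sequentially. s k x = 0"
        using eventually_ge_at_top[of K]
      proof eventually_elim
        case (elim k)
        then have "real K \<le> real k" by simp
        then have "x \<in> {- real k..real k}" using K by (auto simp: abs_le_iff)
        then show ?case by (simp add: s_def)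
      qed
      then show "(\<lambda>k. s k x) \<longlonglongrightarrow> 0"
        by (rule tendsto_eventually)
    qed
  qed simp
  then show ?thesis by (simp add: L2_norm_sq_def s_def[abs_def])
qed

text \<open>Polarization, in the form that upgrades Plancherel from norms to inner products.\<close>

lemma Re_L2_inner_polar:
  assumes "L2_fun f" "L2_fun h"
  shows "Re (L2_inner f h) = (L2_norm_sq (\<lambda>x. f x + h x) - L2_norm_sq f - L2_norm_sq h) / 2"
  using L2_norm_sq_add[OF assms] by simp

lemma Im_L2_inner_polar:
  assumes "L2_fun f" "L2_fun h"
  shows "Im (L2_inner f h) = (L2_norm_sq (\<lambda>x. f x + \<i> * h x) - L2_norm_sq f - L2_norm_sq h) / 2"
proof -
  \<comment> \<open>The second argument is conjugate linear, so the factor comes out as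
    \<open>- \<i>\<close> and the real part of the new inner product is the imaginary part of the
    old one.\<close>
  have "L2_inner f (\<lambda>x. \<i> * h x) = - \<i> * L2_inner f h"
    by (subst L2_inner_commute, subst L2_inner_cmult_left) (simp flip: L2_inner_commute)
  then show ?thesis
    using Re_L2_inner_polar[OF assms(1) L2_fun_cmult[OF assms(2), of \<i>]]
    by (simp add: L2_norm_sq_cmult)
qed

section \<open>Parseval for Fourier series\<close>

text \<open>Fatou and Tonelli are applied to integrals over \<open>count_space\<close>, while the
  sums of the theorem are \<open>infsum\<close>. Both are suprema of finite sums; the infinite type
  provides a bijection with the naturals, along which the counting integral becomes a
  series.\<close>

lemma infsum_ennreal_eq_nn_integral:
  fixes f :: "'a::countable \<Rightarrow> ennreal"
  assumes "infinite (UNIV :: 'a set)"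
  shows "(\<Sum>\<^sub>\<infinity>x\<in>UNIV. f x) = (\<integral>\<^sup>+x. f x \<partial>count_space UNIV)"
proof (rule antisym)
  have *: "infsum f UNIV = (SUP F\<in>{F. finite F \<and> F \<subseteq> UNIV}. sum f F)"
    by (rule nonneg_infsum_complete) simp
  show "infsum f UNIV \<le> (\<integral>\<^sup>+x. f x \<partial>count_space UNIV)"
    unfolding *
  proof (rule SUP_least)
    fix F :: "'a set" assume "F \<in> {F. finite F \<and> F \<subseteq> UNIV}"
    then have F: "finite F" by simp
    have "sum f F = (\<Sum>x\<in>F. f x * indicator F x)" by (intro sum.cong) auto
    also have "\<dots> = (\<integral>\<^sup>+x. f x * indicator F x \<partial>count_space UNIV)"
      using F by (subst nn_integral_count_space'[where A = F]) auto
    also have "\<dots> \<le> (\<integral>\<^sup>+x. f x \<partial>count_space UNIV)"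
      by (intro nn_integral_mono) (auto simp: indicator_def)
    finally show "sum f F \<le> (\<integral>\<^sup>+x. f x \<partial>count_space UNIV)" .
  qed
  define b where "b = from_nat_into (UNIV :: 'a set)"
  have b: "bij_betw b UNIV UNIV"
    unfolding b_def using assms by (intro bij_betw_from_nat_into) auto
  have "(\<integral>\<^sup>+x. f x \<partial>count_space UNIV) = (\<integral>\<^sup>+i. f (b i) \<partial>count_space UNIV)"
    using nn_integral_bij_count_space[OF b, of f] by simp
  also have "\<dots> = (\<Sum>i. f (b i))" by (rule nn_integral_count_space_nat)
  also have "\<dots> = (SUP n. \<Sum>i<n. f (b i))" by (rule suminf_eq_SUP)
  also have "\<dots> \<le> infsum f UNIV"
  proof (rule SUP_least)
    fix n
    have "(\<Sum>i<n. f (b i)) = sum f (b ` {..<n})"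
      using b by (subst sum.reindex) (auto simp: bij_betw_def inj_on_def)
    also have "\<dots> \<le> infsum f UNIV" unfolding * by (rule SUP_upper) auto
    finally show "(\<Sum>i<n. f (b i)) \<le> infsum f UNIV" .
  qed
  finally show "(\<integral>\<^sup>+x. f x \<partial>count_space UNIV) \<le> infsum f UNIV" .
qed

section \<open>Characters on one period\<close>

definition ec :: "real \<Rightarrow> complex" where "ec t = cis (2 * pi * t)"

lemma ec_eq_exp: "ec t = exp (2 * pi * \<i> * of_real t)"
  by (simp add: ec_def cis_conv_exp ac_simps)

lemma ec_add: "ec (s + t) = ec s * ec t"
  by (simp add: ec_def cis_mult distrib_left)

lemma ec_0 [simp]: "ec 0 = 1" by (simp add: ec_def)

lemma ec_of_int [simp]: "ec (of_int n) = 1"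
  using cis_multiple_2pi[of "of_int n"] by (simp add: ec_def mult.commute)

lemma norm_ec [simp]: "cmod (ec t) = 1" by (simp add: ec_def)

lemma cnj_ec: "cnj (ec t) = ec (- t)" by (simp add: ec_def cis_cnj)

lemma continuous_on_ec [continuous_intros]: "continuous_on A f \<Longrightarrow> continuous_on A (\<lambda>x. ec (f x))"
  unfolding ec_def by (intro continuous_intros)

lemma borel_measurable_ec [measurable]: "ec \<in> borel_measurable borel"
  by (intro borel_measurable_continuous_onI continuous_intros)

text \<open>The cutoff makes the character an L2 function on the line, so that Fourier coefficients
  are values of \<open>L2_inner\<close>. It is not normalized: its squared norm is T, the source of
  the factors T in Bessel and Parseval.\<close>

definition trig_char :: "real \<Rightarrow> int \<Rightarrow> real \<Rightarrow> complex" where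
  "trig_char T n x = indicator {0..T} x * ec (of_int n * x / T)"

lemma borel_measurable_trig_char [measurable]: "trig_char T n \<in> borel_measurable borel"
  unfolding trig_char_def by measurable

lemma integrable_indicator_Icc: "integrable lborel (indicator {a..b::real} :: real \<Rightarrow> real)"
  by (rule integrable_real_indicator) (auto simp: emeasure_lborel_Icc_eq)

lemma L2_fun_bounded_Icc:
  assumes [measurable]: "f \<in> borel_measurable borel" and "\<And>x. cmod (f x) \<le> B * indicator {a..b} x"
  shows "L2_fun f"
proof (rule L2_fun_bound)
  show "L2_fun (\<lambda>x. indicator {a..b::real} x)"
  proof (rule L2_funI)
    have "(\<lambda>x. (cmod (indicator {a..b} x))\<^sup>2) = indicat_real {a..b}"
      by (auto simp: indicator_def)
    then show "integrable lborel (\<lambda>x. (cmod (indicator {a..b::real} x))\<^sup>2)"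
      using integrable_indicator_Icc by simp
  qed auto
  show "cmod (f x) \<le> B * cmod (indicator {a..b} x)" for x
    using assms(2)[of x] by (cases "x \<in> {a..b}") auto
qed fact

lemma L2_fun_trig_char: "L2_fun (trig_char T n)"
  by (rule L2_fun_bounded_Icc[where B = 1 and a = 0 and b = T]) (auto simp: trig_char_def norm_mult indicator_def)

lemma integral_ec_period:
  assumes "T > 0"
  shows "(LINT x|lborel. indicator {0..T} x * ec (of_int n * x / T)) = (if n = 0 then of_real T else 0)"
proof (cases "n = 0")
  case True
  have "(LINT x|lborel. complex_of_real (indicator {0..T} x)) = of_real (LINT x|lborel. indicator {0..T} x)"
    by (rule integral_complex_of_real)
  then show ?thesis using True assms by (simp add: of_real_indicator)
next
  case False
  define c where "c = 2 * pi * \<i> * of_int n / T"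
  have c: "c \<noteq> 0" using False assms by (simp add: c_def)
  have ec_c: "ec (of_int n * x / T) = exp (c * of_real x)" for x
    unfolding ec_eq_exp c_def by (rule arg_cong[of _ _ exp]) (simp add: field_simps)
  define F where "F x = ec (of_int n * x / T) / c" for x
  have "has_bochner_integral lborel (\<lambda>x. indicator {0..T} x *\<^sub>R ec (of_int n * x / T)) (F T - F 0)"
  proof (rule has_bochner_integral_FTC_Icc)
    show "(F has_vector_derivative ec (of_int n * x / T)) (at x within {0..T})" for x
      unfolding F_def[abs_def] ec_c using c
      by (intro has_vector_derivative_real_field[where f = "\<lambda>z. exp (c * z) / c"])
        (auto intro!: derivative_eq_intros)
    show "continuous_on {0..T} (\<lambda>x. ec (of_int n * x / T))"
      using assms by (intro continuous_intros) auto
  qed (use assms in auto)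
  moreover have "F T = F 0" using assms by (simp add: F_def)
  ultimately show ?thesis
    using False by (simp add: has_bochner_integral_iff scaleR_conv_of_real of_real_indicator)
qed

lemma L2_inner_trig_char:
  assumes "T > 0"
  shows "L2_inner (trig_char T n) (trig_char T m) = (if n = m then of_real T else 0)"
proof -
  have "trig_char T n x * cnj (trig_char T m x) = indicator {0..T} x * ec (of_int (n - m) * x / T)" for x
    by (auto simp: trig_char_def indicator_def cnj_ec left_diff_distrib diff_divide_distrib simp flip: ec_add)
  then show ?thesis using integral_ec_period[OF assms, of "n - m"] by (simp add: L2_inner_def)
qed

text \<open>Completing the square in the coefficients d. Choosing \<open>d n\<close> as the Fourier
  coefficient divided by T kills the last sum and yields Bessel; discarding that sum, which is
  nonnegative, yields the best approximation property.\<close>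

lemma trig_approx_identity:
  assumes T: "T > 0" and f: "L2_fun f" and S: "finite S"
  shows "T * L2_norm_sq (\<lambda>x. f x - (\<Sum>n\<in>S. d n * trig_char T n x)) =
    T * L2_norm_sq f - (\<Sum>n\<in>S. (cmod (L2_inner f (trig_char T n)))\<^sup>2)
      + (\<Sum>n\<in>S. (cmod (L2_inner f (trig_char T n) - of_real T * d n))\<^sup>2)"
proof -
  define c where "c n = L2_inner f (trig_char T n)" for n
  define p where "p x = (\<Sum>n\<in>S. d n * trig_char T n x)" for x
  have p: "L2_fun p"
    unfolding p_def[abs_def] by (intro L2_fun_sum L2_fun_cmult L2_fun_trig_char)
  have inner_p: "L2_inner p h = (\<Sum>n\<in>S. d n * L2_inner (trig_char T n) h)" if "L2_fun h" for h
    unfolding p_def[abs_def] using that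
    by (subst L2_inner_sum_left) (auto intro: L2_fun_cmult L2_fun_trig_char simp: L2_inner_cmult_left)
  have fp: "L2_inner f p = (\<Sum>n\<in>S. cnj (d n) * c n)"
    using inner_p[OF f] by (subst L2_inner_commute) (simp add: c_def L2_inner_commute[of "trig_char T _" f])
  have "L2_inner (trig_char T n) p = cnj (of_real T * d n)" if "n \<in> S" for n
  proof -
    have "L2_inner p (trig_char T n) = (\<Sum>m\<in>S. if m = n then d n * of_real T else 0)"
      unfolding inner_p[OF L2_fun_trig_char] L2_inner_trig_char[OF T] by (intro sum.cong) auto
    also have "\<dots> = d n * of_real T" using S that by simp
    finally show ?thesis by (subst L2_inner_commute) (simp add: mult.commute)
  qed
  then have "L2_inner p p = (\<Sum>n\<in>S. d n * cnj (of_real T * d n))"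
    unfolding inner_p[OF p] by (intro sum.cong) auto
  also have "\<dots> = of_real (\<Sum>n\<in>S. T * (cmod (d n))\<^sup>2)"
    by (simp add: complex_norm_square ac_simps del: of_real_power)
  finally have pp: "L2_norm_sq p = (\<Sum>n\<in>S. T * (cmod (d n))\<^sup>2)"
    unfolding L2_inner_self of_real_eq_iff .
  have *: "(cmod (c n - of_real T * d n))\<^sup>2 =
      (cmod (c n))\<^sup>2 - 2 * T * Re (cnj (d n) * c n) + T * (T * (cmod (d n))\<^sup>2)" for n
    unfolding cmod_power2 by (simp add: power2_eq_square algebra_simps)
  have "T * L2_norm_sq (\<lambda>x. f x - p x) =
      T * L2_norm_sq f - 2 * T * Re (L2_inner f p) + T * L2_norm_sq p"
    unfolding L2_norm_sq_diff[OF f p] by (simp add: algebra_simps)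
  also have "\<dots> = T * L2_norm_sq f - (\<Sum>n\<in>S. (cmod (c n))\<^sup>2) + (\<Sum>n\<in>S. (cmod (c n - of_real T * d n))\<^sup>2)"
    unfolding * fp pp Re_sum
    by (simp add: sum.distrib sum_subtractf sum_distrib_left del: times_complex.sel)
  finally show ?thesis by (simp add: p_def c_def)
qed

lemma trig_Bessel:
  assumes T: "T > 0" and f: "L2_fun f" and S: "finite S"
  shows "(\<Sum>n\<in>S. (cmod (L2_inner f (trig_char T n)))\<^sup>2) \<le> T * L2_norm_sq f"
proof -
  have "0 \<le> T * L2_norm_sq (\<lambda>x. f x - (\<Sum>n\<in>S. (L2_inner f (trig_char T n) / of_real T) * trig_char T n x))"
    using T by simp
  then show ?thesis
    unfolding trig_approx_identity[OF T f S] using T by simp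
qed

lemma trig_best_approx:
  assumes "T > 0" "L2_fun f" "finite S"
  shows "T * L2_norm_sq f - (\<Sum>n\<in>S. (cmod (L2_inner f (trig_char T n)))\<^sup>2)
     \<le> T * L2_norm_sq (\<lambda>x. f x - (\<Sum>n\<in>S. d n * trig_char T n x))"
  unfolding trig_approx_identity[OF assms] by (simp add: sum_nonneg)

section \<open>Density of trigonometric polynomials\<close>

definition trig_poly :: "(real \<Rightarrow> complex) \<Rightarrow> bool" where
  "trig_poly p \<longleftrightarrow> (\<exists>S d. finite S \<and> p = (\<lambda>x. \<Sum>n\<in>S. d n * ec (of_int n * x)))"

lemma trig_poly_char: "trig_poly (\<lambda>x. c * ec (of_int n * x))"
  unfolding trig_poly_def by (rule exI[of _ "{n}"], rule exI[of _ "\<lambda>_. c"]) simp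

lemma trig_poly_const: "trig_poly (\<lambda>x. c)"
  using trig_poly_char[of c 0] by simp

lemma trig_poly_add:
  assumes "trig_poly p" "trig_poly q" shows "trig_poly (\<lambda>x. p x + q x)"
proof -
  obtain S d where S: "finite S" "p = (\<lambda>x. \<Sum>n\<in>S. d n * ec (of_int n * x))"
    using assms(1) unfolding trig_poly_def by blast
  obtain R e where R: "finite R" "q = (\<lambda>x. \<Sum>n\<in>R. e n * ec (of_int n * x))"
    using assms(2) unfolding trig_poly_def by blast
  define c where "c n = (if n \<in> S then d n else 0) + (if n \<in> R then e n else 0)" for n
  have "p x = (\<Sum>n\<in>S \<union> R. (if n \<in> S then d n else 0) * ec (of_int n * x))" for x
    unfolding S(2) using S(1) R(1) by (intro sum.mono_neutral_cong_left) auto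
  moreover have "q x = (\<Sum>n\<in>S \<union> R. (if n \<in> R then e n else 0) * ec (of_int n * x))" for x
    unfolding R(2) using S(1) R(1) by (intro sum.mono_neutral_cong_left) auto
  ultimately have "(\<lambda>x. p x + q x) = (\<lambda>x. \<Sum>n\<in>S \<union> R. c n * ec (of_int n * x))"
    by (simp add: c_def distrib_right sum.distrib)
  then show ?thesis unfolding trig_poly_def using S(1) R(1) by blast
qed

lemma trig_poly_sum:
  "finite I \<Longrightarrow> (\<And>i. i \<in> I \<Longrightarrow> trig_poly (p i)) \<Longrightarrow> trig_poly (\<lambda>x. \<Sum>i\<in>I. p i x)"
  by (induction I rule: finite_induct) (auto intro: trig_poly_const trig_poly_add)

lemma trig_poly_mult:
  assumes "trig_poly p" "trig_poly q" shows "trig_poly (\<lambda>x. p x * q x)"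
proof -
  obtain S d where S: "finite S" "p = (\<lambda>x. \<Sum>n\<in>S. d n * ec (of_int n * x))"
    using assms(1) unfolding trig_poly_def by blast
  obtain R e where R: "finite R" "q = (\<lambda>x. \<Sum>n\<in>R. e n * ec (of_int n * x))"
    using assms(2) unfolding trig_poly_def by blast
  have "(\<lambda>x. p x * q x) = (\<lambda>x. \<Sum>n\<in>S. \<Sum>m\<in>R. (d n * e m) * ec (of_int (n + m) * x))"
    unfolding S(2) R(2) of_int_add distrib_right ec_add sum_product by (simp add: ac_simps)
  then show ?thesis
    using S(1) R(1) by (simp only:) (intro trig_poly_sum trig_poly_char)
qed

text \<open>The polynomials are real polynomials in Re u and Im u. The only case with content is a
  real-linear f: it equals \<open>Re u * f 1 + Im u * f \<i>\<close>, and on the circle Re u and Im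
  u are combinations of u and its conjugate, that is, of \<open>ec x\<close> and
  \<open>ec (- x)\<close>. This gives the two coefficients below.\<close>

lemma trig_poly_real_polynomial:
  fixes p :: "complex \<Rightarrow> real"
  assumes "real_polynomial_function p"
  shows "trig_poly (\<lambda>x. of_real (p (ec x)))"
  using assms
proof induction
  case (linear f)
  interpret bounded_linear f by fact
  have eq: "complex_of_real (f (ec x)) =
      ((of_real (f 1) - \<i> * of_real (f \<i>)) / 2) * ec (of_int 1 * x)
      + ((of_real (f 1) + \<i> * of_real (f \<i>)) / 2) * ec (of_int (-1) * x)" for x
  proof -
    have "ec x = Re (ec x) *\<^sub>R 1 + Im (ec x) *\<^sub>R \<i>" by (simp add: complex_eq_iff)
    then have "f (ec x) = Re (ec x) * f 1 + Im (ec x) * f \<i>"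
      by (metis add scaleR real_scaleR_def)
    then show ?thesis
      by (simp add: complex_eq_iff field_simps flip: cnj_ec)
  qed
  show ?case unfolding eq by (intro trig_poly_add trig_poly_char)
qed (auto intro: trig_poly_const trig_poly_add trig_poly_mult)

lemma trig_poly_polynomial:
  fixes p :: "complex \<Rightarrow> complex"
  assumes "polynomial_function p"
  shows "trig_poly (\<lambda>x. p (ec x))"
proof -
  have "real_polynomial_function (\<lambda>z. Re (p z))" "real_polynomial_function (\<lambda>z. Im (p z))"
    using assms bounded_linear_Re bounded_linear_Im unfolding polynomial_function_def o_def by blast+
  then have "trig_poly (\<lambda>x. of_real (Re (p (ec x))) + \<i> * of_real (Im (p (ec x))))"
    by (intro trig_poly_add trig_poly_mult trig_poly_const trig_poly_real_polynomial)
  then show ?thesis by (simp flip: complex_eq)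
qed

text \<open>Reduces density to bounded functions, for which almost everywhere convergence can be
  dominated by a constant on the period.\<close>

lemma L2_norm_sq_truncate_values:
  assumes "L2_fun f"
  shows "(\<lambda>k. L2_norm_sq (\<lambda>x. (if cmod (f x) \<le> real k then f x else 0) - f x)) \<longlonglongrightarrow> 0"
proof -
  have f [measurable]: "f \<in> borel_measurable borel" using assms by (rule L2_fun_measurable)
  define s where "s k x = (cmod ((if cmod (f x) \<le> real k then f x else 0) - f x))\<^sup>2" for k x
  have "(\<lambda>k. integral\<^sup>L lborel (s k)) \<longlonglongrightarrow> integral\<^sup>L lborel (\<lambda>x::real. 0)"
  proof (rule integral_dominated_convergence)
    show "s k \<in> borel_measurable lborel" for k
      unfolding s_def by measurable
    show "integrable lborel (\<lambda>x. (cmod (f x))\<^sup>2)" using assms by (rule L2_fun_integrable)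
    show "AE x in lborel. norm (s k x) \<le> (cmod (f x))\<^sup>2" for k
      by (simp add: s_def)
    show "AE x in lborel. (\<lambda>k. s k x) \<longlonglongrightarrow> 0"
    proof (rule AE_I2)
      fix x :: real
      obtain K :: nat where K: "cmod (f x) \<le> real K" using real_arch_simple by blast
      have "\<forall>\<^sub>F k in sequentially. s k x = 0"
        using eventually_ge_at_top[of K]
      proof eventually_elim
        case (elim k)
        then have "cmod (f x) \<le> real k" using K by linarith
        then show ?case by (simp add: s_def)
      qed
      then show "(\<lambda>k. s k x) \<longlonglongrightarrow> 0"
        by (rule tendsto_eventually)
    qed
  qed simp
  then show ?thesis by (simp add: L2_norm_sq_def s_def[abs_def])
qed

text \<open>The cutoff factor vanishing at \<open>1\<close> removes the jump of \<open>Arg2pi\<close>.\<close>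

lemma continuous_on_circle_cutoff:
  fixes g :: "real \<Rightarrow> complex"
  assumes g: "continuous_on UNIV g" and B: "\<And>t. cmod (g t) \<le> B"
  shows "continuous_on (sphere 0 1) (\<lambda>u. of_real (min 1 (K * cmod (u - 1))) * g (c * Arg2pi u))"
  unfolding continuous_on_eq_continuous_within
proof
  fix u :: complex assume u: "u \<in> sphere 0 1"
  show "continuous (at u within sphere 0 1) (\<lambda>u. of_real (min 1 (K * cmod (u - 1))) * g (c * Arg2pi u))"
  proof (cases "u = 1")
    case True
    have "((\<lambda>u. of_real (min 1 (K * cmod (u - 1))) * g (c * Arg2pi u)) \<longlongrightarrow> 0) (at u within sphere 0 1)"
    proof (rule Lim_null_comparison)
      show "\<forall>\<^sub>F v in at u within sphere 0 1. cmod (of_real (min 1 (K * cmod (v - 1))) * g (c * Arg2pi v))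
          \<le> \<bar>min 1 (K * cmod (v - 1))\<bar> * B"
        unfolding norm_mult norm_of_real by (intro always_eventually allI mult_left_mono B) simp
      have "((\<lambda>v. \<bar>min 1 (K * cmod (v - 1))\<bar> * B) \<longlongrightarrow> \<bar>min 1 (K * cmod (u - 1))\<bar> * B) (at u within sphere 0 1)"
        by (intro tendsto_intros)
      then show "((\<lambda>v. \<bar>min 1 (K * cmod (v - 1))\<bar> * B) \<longlongrightarrow> 0) (at u within sphere 0 1)"
        using True by simp
    qed
    then show ?thesis using True by (simp add: continuous_within)
  next
    case False
    have "u \<notin> \<real>\<^sub>\<ge>\<^sub>0"
    proof
      assume "u \<in> \<real>\<^sub>\<ge>\<^sub>0"
      then obtain r where "u = of_real r" "r \<ge> 0" by (rule nonneg_Reals_cases)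
      then show False using u False by simp
    qed
    then have arg: "isCont Arg2pi u" by (rule continuous_at_Arg2pi)
    have g': "isCont g (c * Arg2pi u)" using g by (simp add: continuous_on_eq_continuous_at)
    have "isCont (\<lambda>u. c * Arg2pi u) u"
      by (rule continuous_mult_left) (rule arg)
    then have g_arg: "isCont (\<lambda>u. g (c * Arg2pi u)) u"
      using g' by (rule isCont_o2)
    have cutoff: "isCont (\<lambda>u. complex_of_real (min 1 (K * cmod (u - 1)))) u"
      by (intro continuous_intros)
    show ?thesis
      by (rule continuous_at_imp_continuous_at_within, rule isCont_mult[OF cutoff g_arg])
  qed
qed

lemma Arg2pi_ec:
  assumes "0 \<le> t" "t < 1" shows "Arg2pi (ec t) = 2 * pi * t"
  using assms Arg2pi_unique[of 1 "2 * pi * t" "ec t"] by (simp add: ec_eq_exp ac_simps)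

text \<open>A measurable f is an almost everywhere limit of continuous functions. These are moved to
  the unit circle, where Stone-Weierstrass replaces them by polynomials, and dominated convergence
  turns pointwise into L2 convergence.\<close>

lemma trig_dense_bounded:
  assumes T: "T > 0" and f [measurable]: "f \<in> borel_measurable borel"
    and B: "\<And>x. cmod (f x) \<le> B" and supp: "\<And>x. x \<notin> {0..T} \<Longrightarrow> f x = 0"
  obtains p where "\<And>k. trig_poly (p k)"
    "(\<lambda>k. L2_norm_sq (\<lambda>x. indicator {0..T} x * p k (x / T) - f x)) \<longlonglongrightarrow> 0"
proof -
  have B0: "0 \<le> B" using B[of 0] norm_ge_zero[of "f 0"] by linarith
  have "f measurable_on UNIV"
    using f by (intro lebesgue_measurable_imp_measurable_on) (auto simp: measurable_completion)
  then obtain Z g where Z: "negligible Z" and g: "\<And>k. continuous_on UNIV (g k)"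
    and lim: "\<And>x. x \<notin> Z \<Longrightarrow> (\<lambda>k. g k x) \<longlonglongrightarrow> f x"
    unfolding measurable_on_def by auto
  \<comment> \<open>The approximants \<open>g k\<close> need not be bounded. Projecting their values
    onto the ball of radius B provides a uniform bound and leaves the values of f fixed.\<close>
  define cp where "cp = closest_point (cball (0::complex) B)"
  have cont_cp: "continuous_on A cp" for A
    unfolding cp_def using B0 by (intro continuous_on_closest_point) auto
  have norm_cp: "cmod (cp z) \<le> B" for z
    using closest_point_in_set[of "cball (0::complex) B" z] B0 by (simp add: cp_def)
  have cp_id: "cp z = z" if "cmod z \<le> B" for z
    using that by (simp add: cp_def closest_point_self)
  \<comment> \<open>For fixed u different from 1 the cutoff equals 1 as soon as
    \<open>k \<ge> 1 / cmod (u - 1)\<close>, so it does not disturb the limit.\<close>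
  define h where "h k u = of_real (min 1 (real k * cmod (u - 1))) * cp (g k (T / (2 * pi) * Arg2pi u))"
    for k :: nat and u
  have h: "continuous_on (sphere 0 1) (h k)" for k
    unfolding h_def[abs_def]
    by (rule continuous_on_circle_cutoff[where B = B])
      (auto intro: continuous_on_compose2[OF cont_cp g] norm_cp)
  have norm_h: "cmod (h k u) \<le> B" for k u
  proof -
    have "cmod (h k u) \<le> 1 * B"
      unfolding h_def norm_mult by (intro mult_mono norm_cp) (auto simp: min_def)
    then show ?thesis by simp
  qed
  \<comment> \<open>The accuracy \<open>1 / (1 + real k)\<close> tends to 0 and is never above 1;
    the latter enters the dominating constant.\<close>
  have "\<exists>q. polynomial_function q \<and> (\<forall>u\<in>sphere 0 1. cmod (h k u - q u) < 1 / (1 + real k))" for k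
    by (rule Stone_Weierstrass_polynomial_function) (use h in auto)
  then obtain q where q: "\<And>k. polynomial_function (q k)"
    and hq: "\<And>k u. u \<in> sphere 0 1 \<Longrightarrow> cmod (h k u - q k u) < 1 / (1 + real k)"
    by metis
  have trig: "trig_poly (\<lambda>x. q k (ec x))" for k
    using q by (rule trig_poly_polynomial)
  have [measurable]: "q k \<in> borel_measurable borel" for k
    using q by (intro borel_measurable_continuous_onI continuous_on_polymonial_function)
  have q_lim: "(\<lambda>k. q k (ec (x / T))) \<longlonglongrightarrow> f x" if x: "x \<notin> Z" "0 < x" "x < T" for x
  proof -
    define u where "u = ec (x / T)"
    have arg: "T / (2 * pi) * Arg2pi u = x"
      unfolding u_def using x T by (subst Arg2pi_ec) auto
    have u: "cmod u = 1" "u \<noteq> 1"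
    proof -
      show "u \<noteq> 1" using arg x T Arg2pi_ec[of 0] by auto
    qed (simp add: u_def)
    have "(\<lambda>k. cp (g k x)) \<longlonglongrightarrow> cp (f x)"
      using cont_cp[of UNIV] lim[OF x(1)] by (auto simp: continuous_on_eq_continuous_at intro: isCont_tendsto_compose)
    moreover have "\<forall>\<^sub>F k in sequentially. h k u = cp (g k x)"
    proof -
      obtain K :: nat where K: "1 / cmod (u - 1) \<le> real K" using real_arch_simple by blast
      show ?thesis
        using eventually_ge_at_top[of K]
      proof eventually_elim
        case (elim k)
        then have "1 / cmod (u - 1) \<le> real k" using K by linarith
        then have "1 \<le> real k * cmod (u - 1)" using u by (simp add: field_simps)
        then show ?case using arg by (simp add: h_def)
      qed
    qed
    ultimately have 1: "(\<lambda>k. h k u) \<longlonglongrightarrow> f x"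
      by (simp add: tendsto_cong cp_id[OF B])
    have "(\<lambda>k. h k u - q k u) \<longlonglongrightarrow> 0"
    proof (rule Lim_null_comparison)
      show "\<forall>\<^sub>F k in sequentially. cmod (h k u - q k u) \<le> 1 / (1 + real k)"
        using hq[of u] u by (intro always_eventually allI less_imp_le) auto
      show "(\<lambda>k. 1 / (1 + real k)) \<longlonglongrightarrow> 0" using LIMSEQ_inverse_real_of_nat by (simp add: inverse_eq_divide)
    qed
    from tendsto_diff[OF 1 this] show ?thesis by (simp add: u_def)
  qed
  define s where "s k x = (cmod (indicator {0..T} x * q k (ec (x / T)) - f x))\<^sup>2" for k x
  have "(\<lambda>k. integral\<^sup>L lborel (s k)) \<longlonglongrightarrow> integral\<^sup>L lborel (\<lambda>x::real. 0)"
  proof (rule integral_dominated_convergence)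
    show "s k \<in> borel_measurable lborel" for k
      unfolding s_def by measurable
    \<comment> \<open>The bounds are B for f, B for \<open>h k\<close> and 1 for the
      Stone-Weierstrass error.\<close>
    show "integrable lborel (\<lambda>x. (2 * B + 1)\<^sup>2 * indicator {0..T} x)"
      by (intro integrable_mult_right integrable_indicator_Icc)
    show "AE x in lborel. norm (s k x) \<le> (2 * B + 1)\<^sup>2 * indicator {0..T} x" for k
    proof (rule AE_I2)
      fix x
      show "norm (s k x) \<le> (2 * B + 1)\<^sup>2 * indicator {0..T} x"
      proof (cases "x \<in> {0..T}")
        case True
        define u where "u = ec (x / T)"
        have "cmod (q k u) \<le> cmod (h k u) + cmod (h k u - q k u)"
          using norm_triangle_ineq4[of "h k u" "h k u - q k u"] by simp
        also have "\<dots> \<le> B + 1 / (1 + real k)"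
          using norm_h[of k u] hq[of u k] by (simp add: u_def)
        also have "\<dots> \<le> B + 1" by simp
        finally have "cmod (q k u - f x) \<le> 2 * B + 1"
          using norm_triangle_ineq4[of "q k u" "f x"] B[of x] by linarith
        then show ?thesis using True by (simp add: s_def u_def power_mono)
      qed (simp add: s_def supp)
    qed
    \<comment> \<open>Both endpoints of the period correspond to \<open>u = 1\<close>, where the
      cutoff vanishes, so convergence is not claimed there.\<close>
    have "Z \<union> {0, T} \<in> null_sets lebesgue"
      using Z by (simp add: negligible_iff_null_sets[symmetric])
    then have "AE x in lebesgue. x \<notin> Z \<union> {0, T}" by (rule AE_not_in)
    then have "AE x in lborel. x \<notin> Z \<union> {0, T}" by (simp add: AE_completion_iff)
    then show "AE x in lborel. (\<lambda>k. s k x) \<longlonglongrightarrow> 0"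
    proof eventually_elim
      case (elim x)
      show ?case
      proof (cases "x \<in> {0..T}")
        case True
        then have "(\<lambda>k. q k (ec (x / T)) - f x) \<longlonglongrightarrow> f x - f x"
          using elim by (intro tendsto_diff q_lim) auto
        then have "(\<lambda>k. (cmod (q k (ec (x / T)) - f x))\<^sup>2) \<longlonglongrightarrow> (cmod 0)\<^sup>2"
          by (intro tendsto_intros) auto
        then show ?thesis using True by (simp add: s_def)
      qed (simp add: s_def supp)
    qed
  qed simp
  then have "(\<lambda>k. L2_norm_sq (\<lambda>x. indicator {0..T} x * q k (ec (x / T)) - f x)) \<longlonglongrightarrow> 0"
    by (simp add: L2_norm_sq_def s_def[abs_def])
  with trig show thesis by (rule that)
qed

lemma trig_dense:
  assumes T: "T > 0" and f: "L2_fun f" and supp: "\<And>x. x \<notin> {0..T} \<Longrightarrow> f x = 0" and e: "e > 0"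
  obtains S d where "finite S" "L2_norm_sq (\<lambda>x. f x - (\<Sum>n\<in>S. d n * trig_char T n x)) < e"
proof -
  have f_meas [measurable]: "f \<in> borel_measurable borel" using f by (rule L2_fun_measurable)
  have "\<forall>\<^sub>F k in sequentially. L2_norm_sq (\<lambda>x. (if cmod (f x) \<le> real k then f x else 0) - f x) < e / 4"
    using e by (intro order_tendstoD(2)[OF L2_norm_sq_truncate_values[OF f]]) auto
  then obtain K where K: "L2_norm_sq (\<lambda>x. (if cmod (f x) \<le> real K then f x else 0) - f x) < e / 4"
    by (auto simp: eventually_sequentially)
  define g where "g x = (if cmod (f x) \<le> real K then f x else 0)" for x
  have g_meas: "g \<in> borel_measurable borel" unfolding g_def by measurable
  have g: "L2_fun g"
    by (rule L2_fun_bound[OF f g_meas, where C = 1]) (auto simp: g_def)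
  obtain p where p: "\<And>k. trig_poly (p k)"
    and lim: "(\<lambda>k. L2_norm_sq (\<lambda>x. indicator {0..T} x * p k (x / T) - g x)) \<longlonglongrightarrow> 0"
    by (rule trig_dense_bounded[OF T g_meas, where B = "real K"]) (auto simp: g_def supp)
  have "\<forall>\<^sub>F k in sequentially. L2_norm_sq (\<lambda>x. indicator {0..T} x * p k (x / T) - g x) < e / 4"
    using e by (intro order_tendstoD(2)[OF lim]) auto
  then obtain k where k: "L2_norm_sq (\<lambda>x. indicator {0..T} x * p k (x / T) - g x) < e / 4"
    by (auto simp: eventually_sequentially)
  obtain S d where S: "finite S" and pk: "p k = (\<lambda>x. \<Sum>n\<in>S. d n * ec (of_int n * x))"
    using p[of k] unfolding trig_poly_def by blast
  define P where "P x = (\<Sum>n\<in>S. d n * trig_char T n x)" for x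
  have P_eq: "indicator {0..T} x * p k (x / T) = P x" for x
    by (simp add: P_def pk trig_char_def sum_distrib_left ac_simps)
  have P: "L2_fun P"
    unfolding P_def[abs_def] by (intro L2_fun_sum L2_fun_cmult L2_fun_trig_char)
  have "L2_norm_sq (\<lambda>x. P x - f x) = L2_norm_sq (\<lambda>x. (P x - g x) + (g x - f x))" by simp
  also have "\<dots> \<le> 2 * L2_norm_sq (\<lambda>x. P x - g x) + 2 * L2_norm_sq (\<lambda>x. g x - f x)"
    using P g f by (intro L2_norm_sq_add_le) auto
  also have "\<dots> < e"
    using K k unfolding P_eq g_def by simp
  finally have "L2_norm_sq (\<lambda>x. f x - (\<Sum>n\<in>S. d n * trig_char T n x)) < e"
    by (simp add: P_def L2_norm_sq_minus_commute)
  with S show thesis by (rule that)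
qed

text \<open>Bessel bounds every finite subsum, hence the supremum. Conversely, a trigonometric
  polynomial within \<open>e / T\<close> of f shows by best approximation that the coefficients over
  its finite index set miss \<open>T * L2_norm_sq f\<close> by less than e.\<close>

lemma Parseval:
  assumes T: "T > 0" and f: "L2_fun f" and supp: "\<And>x. x \<notin> {0..T} \<Longrightarrow> f x = 0"
  shows "(\<integral>\<^sup>+n. ennreal ((cmod (L2_inner f (trig_char T n)))\<^sup>2) \<partial>count_space UNIV)
    = ennreal (T * L2_norm_sq f)"
proof -
  define c where "c n = (cmod (L2_inner f (trig_char T n)))\<^sup>2" for n
  have sums: "(\<Sum>n\<in>S. ennreal (c n)) = ennreal (\<Sum>n\<in>S. c n)" for S
    by (simp add: c_def sum_nonneg sum_ennreal)
  have *: "(\<Sum>\<^sub>\<infinity>n\<in>UNIV. ennreal (c n)) = (SUP S\<in>{S. finite S \<and> S \<subseteq> UNIV}. \<Sum>n\<in>S. ennreal (c n))"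
    by (rule nonneg_infsum_complete) simp
  have "(\<Sum>\<^sub>\<infinity>n\<in>UNIV. ennreal (c n)) = ennreal (T * L2_norm_sq f)"
  proof (rule antisym)
    show "(\<Sum>\<^sub>\<infinity>n\<in>UNIV. ennreal (c n)) \<le> ennreal (T * L2_norm_sq f)"
      unfolding * sums
      using trig_Bessel[OF T f] by (intro SUP_least ennreal_leI) (auto simp: c_def)
    show "ennreal (T * L2_norm_sq f) \<le> (\<Sum>\<^sub>\<infinity>n\<in>UNIV. ennreal (c n))"
    proof (rule ennreal_le_epsilon)
      fix e :: real assume e: "e > 0"
      then have "e / T > 0" using T by simp
      then obtain S d where S: "finite S"
        and less: "L2_norm_sq (\<lambda>x. f x - (\<Sum>n\<in>S. d n * trig_char T n x)) < e / T"
        using trig_dense[OF T f supp] by blast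
      have "T * L2_norm_sq f - (\<Sum>n\<in>S. c n) \<le> T * L2_norm_sq (\<lambda>x. f x - (\<Sum>n\<in>S. d n * trig_char T n x))"
        unfolding c_def by (rule trig_best_approx[OF T f S])
      also have "\<dots> < e" using less T by (simp add: field_simps)
      finally have "T * L2_norm_sq f \<le> (\<Sum>n\<in>S. c n) + e" by simp
      then have "ennreal (T * L2_norm_sq f) \<le> ennreal ((\<Sum>n\<in>S. c n) + e)"
        by (rule ennreal_leI)
      also have "\<dots> = (\<Sum>n\<in>S. ennreal (c n)) + ennreal e"
        using e unfolding sums by (intro ennreal_plus) (auto simp: c_def sum_nonneg)
      also have "\<dots> \<le> (\<Sum>\<^sub>\<infinity>n\<in>UNIV. ennreal (c n)) + ennreal e"
        unfolding * using S by (intro add_right_mono SUP_upper) auto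
      finally show "ennreal (T * L2_norm_sq f) \<le> (\<Sum>\<^sub>\<infinity>n\<in>UNIV. ennreal (c n)) + ennreal e" .
    qed
  qed
  then show ?thesis
    by (simp add: c_def infsum_ennreal_eq_nn_integral)
qed

section \<open>Plancherel for the Fourier transform\<close>

text \<open>Tonelli over the half-open unit intervals, which count every point exactly once. It
  turns an identity for all translates of a sampling lattice into one for the integral over the
  line.\<close>

lemma nn_integral_unfold_periods:
  fixes h :: "real \<Rightarrow> ennreal"
  assumes [measurable]: "h \<in> borel_measurable borel"
  shows "(\<integral>\<^sup>+x. h x \<partial>lborel) = (\<integral>\<^sup>+t\<in>{0..<1}. (\<integral>\<^sup>+n. h (t + of_int n) \<partial>count_space (UNIV :: int set)) \<partial>lborel)"
proof -
  have *: "h x = (\<integral>\<^sup>+n. h x * indicator {of_int n..<of_int n + 1} x \<partial>count_space (UNIV :: int set))" for x :: real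
    by (subst nn_integral_count_space'[where A = "{\<lfloor>x\<rfloor>}"]) (auto simp: indicator_def, linarith+)
  have piece: "(\<integral>\<^sup>+x. h x * indicator {of_int n..<of_int n + 1} x \<partial>lborel)
      = (\<integral>\<^sup>+t. h (t + of_int n) * indicator {0..<1} t \<partial>lborel)" for n :: int
    by (subst nn_integral_real_affine[where c = 1 and t = "of_int n"])
      (auto simp: indicator_def add.commute intro!: nn_integral_cong)
  from * have "(\<integral>\<^sup>+x. h x \<partial>lborel) =
      (\<integral>\<^sup>+x. (\<integral>\<^sup>+n. h x * indicator {of_int n..<of_int n + 1} x \<partial>count_space (UNIV :: int set)) \<partial>lborel)"
    by simp
  also have "\<dots> = (\<integral>\<^sup>+n. (\<integral>\<^sup>+x. h x * indicator {of_int n..<of_int n + 1} x \<partial>lborel) \<partial>count_space (UNIV :: int set))"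
    by (intro nn_integral_count_space_nn_integral) auto
  also have "\<dots> = (\<integral>\<^sup>+n. (\<integral>\<^sup>+t. h (t + of_int n) * indicator {0..<1} t \<partial>lborel) \<partial>count_space (UNIV :: int set))"
    unfolding piece ..
  also have "\<dots> = (\<integral>\<^sup>+t. (\<integral>\<^sup>+n. h (t + of_int n) * indicator {0..<1} t \<partial>count_space (UNIV :: int set)) \<partial>lborel)"
    by (intro nn_integral_count_space_nn_integral[symmetric]) auto
  also have "\<dots> = (\<integral>\<^sup>+t\<in>{0..<1}. (\<integral>\<^sup>+n. h (t + of_int n) \<partial>count_space (UNIV :: int set)) \<partial>lborel)"
    by (simp add: nn_integral_multc)
  finally show ?thesis .
qed

lemma nn_integral_norm_sq_eq:
  "L2_fun f \<Longrightarrow> (\<integral>\<^sup>+x. ennreal ((cmod (f x))\<^sup>2) \<partial>lborel) = ennreal (L2_norm_sq f)"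
  unfolding L2_norm_sq_def by (intro nn_integral_eq_integral L2_fun_integrable) auto

lemma L2_fun_nn_integral_le:
  assumes [measurable]: "f \<in> borel_measurable borel"
    and le: "(\<integral>\<^sup>+x. ennreal ((cmod (f x))\<^sup>2) \<partial>lborel) \<le> ennreal C"
  shows "L2_fun f"
proof (rule L2_funI)
  show "integrable lborel (\<lambda>x. (cmod (f x))\<^sup>2)"
    using le by (intro integrableI_nonneg) (auto simp: less_top[symmetric] top_unique)
qed auto

lemma L2_norm_sq_nn_integral_le:
  assumes "L2_fun f" "(\<integral>\<^sup>+x. ennreal ((cmod (f x))\<^sup>2) \<partial>lborel) \<le> ennreal C" "0 \<le> C"
  shows "L2_norm_sq f \<le> C"
  using assms by (simp add: nn_integral_norm_sq_eq)

text \<open>The inverse Fourier transform as a Bochner integral. That integral is 0 by convention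
  when the integrand is not integrable, so the Plancherel lemmas assume integrability besides
  \<open>L2_fun\<close>.\<close>

definition itrans :: "(real \<Rightarrow> complex) \<Rightarrow> real \<Rightarrow> complex" where
  "itrans F t = (LINT x|lborel. F x * ec (x * t))"

lemma borel_measurable_itrans [measurable]:
  assumes [measurable]: "F \<in> borel_measurable borel"
  shows "itrans F \<in> borel_measurable borel"
  unfolding itrans_def[abs_def] by measurable

lemma integrable_mult_ec:
  assumes "integrable lborel F" and [measurable]: "c \<in> borel_measurable borel"
  shows "integrable lborel (\<lambda>x. F x * ec (c x))"
proof (rule Bochner_Integration.integrable_bound[OF assms(1)])
  have [measurable]: "F \<in> borel_measurable borel" using assms(1) by auto
  show "(\<lambda>x. F x * ec (c x)) \<in> borel_measurable lborel" by measurable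
qed (simp add: norm_mult)

lemma itrans_add:
  "integrable lborel F \<Longrightarrow> integrable lborel H \<Longrightarrow> itrans (\<lambda>x. F x + H x) = (\<lambda>t. itrans F t + itrans H t)"
  by (rule ext) (simp add: itrans_def distrib_right integrable_mult_ec)

lemma itrans_diff:
  "integrable lborel F \<Longrightarrow> integrable lborel H \<Longrightarrow> itrans (\<lambda>x. F x - H x) = (\<lambda>t. itrans F t - itrans H t)"
  by (rule ext) (simp add: itrans_def left_diff_distrib integrable_mult_ec)

lemma itrans_cmult: "itrans (\<lambda>x. c * F x) = (\<lambda>t. c * itrans F t)"
  by (rule ext) (simp add: itrans_def mult.assoc)

lemma L2_fun_Icc_integrable:
  assumes "L2_fun F" "\<And>x. x \<notin> {a..b} \<Longrightarrow> F x = 0"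
  shows "integrable lborel F"
proof -
  have "L2_fun (indicator {a..b})"
    by (rule L2_fun_bounded_Icc[where B = 1 and a = a and b = b]) (auto simp: indicator_def)
  then have "integrable lborel (\<lambda>x. F x * indicator {a..b} x)"
    using assms(1) by (intro L2_fun_mult_integrable)
  also have "(\<lambda>x. F x * indicator {a..b} x) = F"
    using assms(2) by (force simp: indicator_def)
  finally show ?thesis .
qed

text \<open>Sampling on a lattice of mesh \<open>1/(2R)\<close> is an isometry by Parseval;
  averaging over the translates of the lattice gives the integral.\<close>

lemma Plancherel_Icc:
  assumes R: "R > 0" and F: "L2_fun F" and supp: "\<And>x. x \<notin> {-R..R} \<Longrightarrow> F x = 0"
  shows "(\<integral>\<^sup>+t. ennreal ((cmod (itrans F t))\<^sup>2) \<partial>lborel) = ennreal (L2_norm_sq F)"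
proof -
  define T where "T = 2 * R"
  have T: "T > 0" using R by (simp add: T_def)
  have F_meas [measurable]: "F \<in> borel_measurable borel" using F by (rule L2_fun_measurable)
  have sample: "(\<integral>\<^sup>+n. ennreal ((cmod (itrans F (- ((s + of_int n) / T))))\<^sup>2) \<partial>count_space (UNIV :: int set))
      = ennreal (T * L2_norm_sq F)" for s
  proof -
    \<comment> \<open>F is modulated to account for the offset s of the lattice and moved from
      \<open>{-R..R}\<close> to \<open>{0..T}\<close>. Its n-th Fourier coefficient is then, up to a
      factor of modulus 1, the sample of \<open>itrans F\<close> at
      \<open>- ((s + n) / T)\<close>.\<close>
    define f where "f y = ec (- (y - R) * s / T) * F (y - R)" for y
    have f_shift: "f (y + R) = ec (- y * s / T) * F y" for y by (simp add: f_def)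
    have "L2_fun (\<lambda>y. f (y + R))"
      unfolding f_shift by (rule L2_fun_mult_bounded[OF F, where B = 1]) auto
    then have f: "L2_fun f" by (simp add: L2_fun_shift_iff)
    have norm_f: "L2_norm_sq f = L2_norm_sq F"
      using L2_norm_sq_shift[of f R, symmetric] by (simp add: f_shift L2_norm_sq_def norm_mult)
    have f0: "f y = 0" if "y \<notin> {0..T}" for y
      using that supp[of "y - R"] by (auto simp: f_def T_def)
    have "cmod (L2_inner f (trig_char T n)) = cmod (itrans F (- ((s + of_int n) / T)))" for n
    proof -
      have "L2_inner f (trig_char T n) = (LINT y|lborel. f y * ec (- (of_int n * y / T)))"
        unfolding L2_inner_def using f0
        by (intro Bochner_Integration.integral_cong) (auto simp: trig_char_def indicator_def cnj_ec)
      also have "\<dots> = (LINT y|lborel. f (y + R) * ec (- (of_int n * (y + R) / T)))"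
        using lborel_integral_real_affine[of 1 "\<lambda>y. f y * ec (- (of_int n * y / T))" R]
        by (simp add: add.commute)
      also have "\<dots> = (LINT y|lborel. ec (- (of_int n * R / T)) * (F y * ec (y * (- ((s + of_int n) / T)))))"
      proof (rule Bochner_Integration.integral_cong)
        fix y
        have "- y * s / T + - (of_int n * (y + R) / T)
            = - (of_int n * R / T) + y * (- ((s + of_int n) / T))"
          using T by (simp add: field_simps)
        then have "ec (- y * s / T) * ec (- (of_int n * (y + R) / T))
            = ec (- (of_int n * R / T)) * ec (y * (- ((s + of_int n) / T)))"
          by (simp only: flip: ec_add)
        then show "f (y + R) * ec (- (of_int n * (y + R) / T)) =
            ec (- (of_int n * R / T)) * (F y * ec (y * (- ((s + of_int n) / T))))"
          unfolding f_shift by (metis mult.assoc mult.commute)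
      qed simp
      also have "\<dots> = ec (- (of_int n * R / T)) * itrans F (- ((s + of_int n) / T))"
        by (simp add: itrans_def)
      finally show ?thesis by (simp add: norm_mult)
    qed
    then show ?thesis
      using Parseval[OF T f f0] by (simp add: norm_f)
  qed
  \<comment> \<open>The Jacobian \<open>1 / T\<close> of this rescaling cancels the T of
    Parseval.\<close>
  have "(\<integral>\<^sup>+t. ennreal ((cmod (itrans F t))\<^sup>2) \<partial>lborel)
      = ennreal (1 / T) * (\<integral>\<^sup>+s. ennreal ((cmod (itrans F (- (s / T))))\<^sup>2) \<partial>lborel)"
    using T by (subst nn_integral_real_affine[where c = "- (1 / T)" and t = 0]) auto
  also have "(\<integral>\<^sup>+s. ennreal ((cmod (itrans F (- (s / T))))\<^sup>2) \<partial>lborel)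
      = (\<integral>\<^sup>+s\<in>{0..<1::real}. ennreal (T * L2_norm_sq F) \<partial>lborel)"
    by (subst nn_integral_unfold_periods) (simp_all add: sample)
  also have "\<dots> = ennreal (T * L2_norm_sq F)"
    by (subst nn_integral_cmult_indicator) auto
  also have "ennreal (1 / T) * ennreal (T * L2_norm_sq F) = ennreal (L2_norm_sq F)"
    using T by (simp flip: ennreal_mult)
  finally show ?thesis .
qed

lemma itrans_truncation_tendsto:
  assumes F: "integrable lborel F"
  shows "(\<lambda>k. itrans (\<lambda>x. indicator {- real k..real k} x * F x) t) \<longlonglongrightarrow> itrans F t"
  unfolding itrans_def
proof (rule integral_dominated_convergence)
  have [measurable]: "F \<in> borel_measurable borel" using F by auto
  show "(\<lambda>x. F x * ec (x * t)) \<in> borel_measurable lborel" by measurable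
  show "(\<lambda>x. indicator {- real k..real k} x * F x * ec (x * t)) \<in> borel_measurable lborel" for k
    by measurable
  show "integrable lborel (\<lambda>x. cmod (F x))" using F by simp
  show "AE x in lborel. norm (indicator {- real k..real k} x * F x * ec (x * t)) \<le> cmod (F x)" for k
    by (auto simp: norm_mult indicator_def)
  show "AE x in lborel. (\<lambda>k. indicator {- real k..real k} x * F x * ec (x * t)) \<longlonglongrightarrow> F x * ec (x * t)"
  proof (rule AE_I2)
    fix x :: real
    obtain K :: nat where K: "\<bar>x\<bar> \<le> real K" using real_arch_simple by blast
    have "\<forall>\<^sub>F k in sequentially. indicator {- real k..real k} x * F x * ec (x * t) = F x * ec (x * t)"
      using eventually_ge_at_top[of K]
    proof eventually_elim
      case (elim k)
      then have "real K \<le> real k" by simp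
      then have "x \<in> {- real k..real k}" using K by (auto simp: abs_le_iff)
      then show ?case by simp
    qed
    then show "(\<lambda>k. indicator {- real k..real k} x * F x * ec (x * t)) \<longlonglongrightarrow> F x * ec (x * t)"
      by (rule tendsto_eventually)
  qed
qed

text \<open>Truncations of F have pointwise convergent transforms, so Fatou applies. The inequality
  already makes \<open>itrans F\<close> square-integrable, which has to be known before norms can be
  compared.\<close>

lemma Plancherel_le:
  assumes F: "L2_fun F" "integrable lborel F"
  shows "(\<integral>\<^sup>+t. ennreal ((cmod (itrans F t))\<^sup>2) \<partial>lborel) \<le> ennreal (L2_norm_sq F)"
proof -
  have F_meas [measurable]: "F \<in> borel_measurable borel" using F(1) by (rule L2_fun_measurable)
  define Fk where "Fk k x = indicator {- real k..real k} x * F x" for k x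
  have Fk_meas [measurable]: "Fk k \<in> borel_measurable borel" for k unfolding Fk_def by measurable
  have Fk: "L2_fun (Fk k)" for k unfolding Fk_def[abs_def] using F(1) by auto
  have norm_le: "L2_norm_sq (Fk k) \<le> L2_norm_sq F" for k
    unfolding L2_norm_sq_def
    using F(1) Fk[of k]
    by (intro integral_mono) (auto simp: L2_fun_integrable, simp add: Fk_def indicator_def)
  have le: "(\<integral>\<^sup>+t. ennreal ((cmod (itrans (Fk k) t))\<^sup>2) \<partial>lborel) \<le> ennreal (L2_norm_sq F)" for k
  proof -
    have "(\<integral>\<^sup>+t. ennreal ((cmod (itrans (Fk k) t))\<^sup>2) \<partial>lborel) = ennreal (L2_norm_sq (Fk k))"
      by (rule Plancherel_Icc[where R = "real k + 1", OF _ Fk]) (auto simp: Fk_def indicator_def)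
    then show ?thesis using norm_le by (simp add: ennreal_leI)
  qed
  have "(\<lambda>k. ennreal ((cmod (itrans (Fk k) t))\<^sup>2)) \<longlonglongrightarrow> ennreal ((cmod (itrans F t))\<^sup>2)" for t
    unfolding Fk_def[abs_def] by (intro tendsto_ennrealI tendsto_intros itrans_truncation_tendsto F)
  then have "liminf (\<lambda>k. ennreal ((cmod (itrans (Fk k) t))\<^sup>2)) = ennreal ((cmod (itrans F t))\<^sup>2)" for t
    by (intro lim_imp_Liminf) simp_all
  then have "(\<integral>\<^sup>+t. ennreal ((cmod (itrans F t))\<^sup>2) \<partial>lborel)
      = (\<integral>\<^sup>+t. liminf (\<lambda>k. ennreal ((cmod (itrans (Fk k) t))\<^sup>2)) \<partial>lborel)"
    by simp
  also have "\<dots> \<le> liminf (\<lambda>k. \<integral>\<^sup>+t. ennreal ((cmod (itrans (Fk k) t))\<^sup>2) \<partial>lborel)"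
    by (rule nn_integral_liminf) measurable
  also have "\<dots> \<le> ennreal (L2_norm_sq F)"
    by (rule Liminf_le) (use le in \<open>auto intro: always_eventually\<close>)
  finally show ?thesis .
qed

lemma L2_fun_itrans:
  assumes "L2_fun F" "integrable lborel F" shows "L2_fun (itrans F)"
  using Plancherel_le[OF assms] assms(1)
  by (intro L2_fun_nn_integral_le) (auto dest: L2_fun_measurable)

text \<open>The preceding inequality, applied to the difference of a truncation and F, shows that
  the transforms of the truncations converge in L2. The equality for bounded support then passes to
  the limit on both sides.\<close>

lemma Plancherel:
  assumes F: "L2_fun F" "integrable lborel F"
  shows "L2_norm_sq (itrans F) = L2_norm_sq F"
proof -
  define Fk where "Fk k x = indicator {- real k..real k} x * F x" for k x
  have Fk: "L2_fun (Fk k)" for k unfolding Fk_def[abs_def] using F(1) by auto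
  have Fk0: "x \<notin> {- (real k + 1)..real k + 1} \<Longrightarrow> Fk k x = 0" for k x by (auto simp: Fk_def indicator_def)
  have Fk1: "integrable lborel (Fk k)" for k
    by (rule L2_fun_Icc_integrable[OF Fk Fk0])
  have eq: "L2_norm_sq (itrans (Fk k)) = L2_norm_sq (Fk k)" for k
  proof -
    have "ennreal (L2_norm_sq (itrans (Fk k))) = ennreal (L2_norm_sq (Fk k))"
      using Plancherel_Icc[of "real k + 1" "Fk k"] Fk Fk0 by (simp add: nn_integral_norm_sq_eq L2_fun_itrans[OF Fk Fk1])
    then show ?thesis by simp
  qed
  have lim: "(\<lambda>k. L2_norm_sq (\<lambda>x. Fk k x - F x)) \<longlonglongrightarrow> 0"
    unfolding Fk_def by (rule L2_truncation[OF F(1)])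
  have "(\<lambda>k. L2_norm_sq (\<lambda>t. itrans (Fk k) t - itrans F t)) \<longlonglongrightarrow> 0"
  proof (rule tendsto_sandwich[OF _ _ tendsto_const lim])
    show "\<forall>\<^sub>F k in sequentially. L2_norm_sq (\<lambda>t. itrans (Fk k) t - itrans F t) \<le> L2_norm_sq (\<lambda>x. Fk k x - F x)"
    proof (intro always_eventually allI)
      fix k
      have d: "L2_fun (\<lambda>x. Fk k x - F x)" "integrable lborel (\<lambda>x. Fk k x - F x)"
        using F Fk Fk1 by auto
      have "L2_norm_sq (itrans (\<lambda>x. Fk k x - F x)) \<le> L2_norm_sq (\<lambda>x. Fk k x - F x)"
        by (intro L2_norm_sq_nn_integral_le L2_fun_itrans Plancherel_le d) simp
      then show "L2_norm_sq (\<lambda>t. itrans (Fk k) t - itrans F t) \<le> L2_norm_sq (\<lambda>x. Fk k x - F x)"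
        by (simp add: itrans_diff F(2) Fk1)
    qed
  qed simp
  then have "(\<lambda>k. L2_norm_sq (itrans (Fk k))) \<longlonglongrightarrow> L2_norm_sq (itrans F)"
    by (intro L2_norm_sq_tendsto L2_fun_itrans F Fk Fk1)
  moreover have "(\<lambda>k. L2_norm_sq (itrans (Fk k))) \<longlonglongrightarrow> L2_norm_sq F"
    unfolding eq by (intro L2_norm_sq_tendsto F Fk lim)
  ultimately show ?thesis by (rule LIMSEQ_unique)
qed

lemma Plancherel_inner:
  assumes F: "L2_fun F" "integrable lborel F" and H: "L2_fun H" "integrable lborel H"
  shows "L2_inner (itrans F) (itrans H) = L2_inner F H"
proof -
  have 1: "L2_norm_sq (\<lambda>t. itrans F t + itrans H t) = L2_norm_sq (\<lambda>x. F x + H x)"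
    using Plancherel[of "\<lambda>x. F x + H x"] F H by (auto simp: itrans_add)
  have 2: "L2_norm_sq (\<lambda>t. itrans F t + \<i> * itrans H t) = L2_norm_sq (\<lambda>x. F x + \<i> * H x)"
    using Plancherel[of "\<lambda>x. F x + \<i> * H x", OF L2_fun_add[OF F(1) L2_fun_cmult[OF H(1)]]] F H
    by (simp add: itrans_add itrans_cmult)
  show ?thesis
    unfolding complex_eq_iff
    by (simp add: Re_L2_inner_polar Im_L2_inner_polar L2_fun_itrans F H Plancherel 1 2)
qed

text \<open>Fubini: the adjoint of the inverse transform is the forward transform, obtained by
  reflecting the argument.\<close>

lemma L2_inner_itrans_left:
  assumes F: "integrable lborel F" and f: "integrable lborel f"
  shows "L2_inner (itrans F) f = L2_inner F (\<lambda>x. itrans f (- x))"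
proof -
  have [measurable]: "F \<in> borel_measurable borel" "f \<in> borel_measurable borel"
    using F f by auto
  define \<phi> where "\<phi> x t = F x * ec (x * t) * cnj (f t)" for x t
  have "integrable (lborel \<Otimes>\<^sub>M lborel) (case_prod \<phi>)"
  proof (rule lborel_pair.Fubini_integrable)
    show "case_prod \<phi> \<in> borel_measurable (lborel \<Otimes>\<^sub>M lborel)"
      unfolding \<phi>_def by measurable
    have "integrable lborel (\<lambda>x. cmod (F x) * (LINT t|lborel. cmod (f t)))"
      using F by simp
    then show "integrable lborel (\<lambda>x. LINT t|lborel. norm (case_prod \<phi> (x, t)))"
      by (simp add: \<phi>_def norm_mult)
    have "integrable lborel (\<lambda>t. cnj (f t) * ec (x * t))" for x
      using f by (intro integrable_mult_ec) auto
    then have "integrable lborel (\<lambda>t. F x * (cnj (f t) * ec (x * t)))" for x by simp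
    then show "AE x in lborel. integrable lborel (\<lambda>t. case_prod \<phi> (x, t))"
      by (simp add: \<phi>_def ac_simps)
  qed
  then have "(LINT t|lborel. LINT x|lborel. \<phi> x t) = (LINT x|lborel. LINT t|lborel. \<phi> x t)"
    by (rule lborel_pair.Fubini_integral)
  also have "(\<lambda>t. LINT x|lborel. \<phi> x t) = (\<lambda>t. itrans F t * cnj (f t))"
    by (simp add: \<phi>_def itrans_def)
  also have "(\<lambda>x. LINT t|lborel. \<phi> x t) = (\<lambda>x. F x * cnj (itrans f (- x)))"
  proof
    fix x
    have "(LINT t|lborel. \<phi> x t) = (LINT t|lborel. F x * cnj (f t * ec (t * (- x))))"
      by (intro Bochner_Integration.integral_cong) (simp_all add: \<phi>_def cnj_ec ac_simps)
    also have "\<dots> = F x * (LINT t|lborel. cnj (f t * ec (t * (- x))))"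
      by (rule integral_mult_right_zero)
    also have "(LINT t|lborel. cnj (f t * ec (t * (- x)))) = cnj (itrans f (- x))"
      unfolding itrans_def by (rule Bochner_Integration.integral_cnj)
    finally show "(LINT t|lborel. \<phi> x t) = F x * cnj (itrans f (- x))" .
  qed
  finally show ?thesis by (simp add: L2_inner_def)
qed

text \<open>The preimage of a truncation g of f should be its forward transform h, which is
  truncated again to \<open>F k\<close> because it need not be integrable. By the adjoint formula
  the inner product of \<open>itrans (F k)\<close> with g is the squared norm of \<open>F k\<close>.
  Hence the squared error is the squared norm of g minus that of \<open>F k\<close>, and it tends to
  0 since h and g have equal norms. No pointwise inversion formula is involved.\<close>

lemma itrans_dense:
  assumes f: "L2_fun f" and e: "e > 0"
  obtains R F where "L2_fun F" "\<And>x. x \<notin> {-R..R} \<Longrightarrow> F x = 0" "L2_norm_sq (\<lambda>t. itrans F t - f t) < e"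
proof -
  have "\<forall>\<^sub>F k in sequentially. L2_norm_sq (\<lambda>x. indicator {- real k..real k} x * f x - f x) < e / 4"
    using e by (intro order_tendstoD(2)[OF L2_truncation[OF f]]) auto
  then obtain K where K: "L2_norm_sq (\<lambda>x. indicator {- real K..real K} x * f x - f x) < e / 4"
    by (auto simp: eventually_sequentially)
  define g where "g x = indicator {- real K..real K} x * f x" for x
  have g: "L2_fun g" unfolding g_def[abs_def] using f by auto
  have g1: "integrable lborel g"
    by (rule L2_fun_Icc_integrable[OF g, of "- real K" "real K"]) (simp add: g_def)
  define h where "h x = itrans g (- x)" for x
  have ig: "L2_fun (itrans g)" using g g1 by (rule L2_fun_itrans)
  have [measurable]: "itrans g \<in> borel_measurable borel" using ig by (rule L2_fun_measurable)
  have h: "L2_fun h"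
  proof (rule L2_funI)
    show "integrable lborel (\<lambda>x. (cmod (h x))\<^sup>2)"
      using lborel_integrable_real_affine[OF L2_fun_integrable[OF ig], of "-1" 0] by (simp add: h_def)
  qed (simp add: h_def[abs_def])
  have "L2_norm_sq h = L2_norm_sq (itrans g)"
    unfolding L2_norm_sq_def h_def
    using lborel_integral_real_affine[of "-1" "\<lambda>x. (cmod (itrans g x))\<^sup>2" 0] by simp
  then have norm_h: "L2_norm_sq h = L2_norm_sq g" using Plancherel[OF g g1] by simp
  define F where "F k x = indicator {- real k..real k} x * h x" for k x
  have F: "L2_fun (F k)" for k unfolding F_def[abs_def] using h by auto
  have F0: "F k x = 0" if "x \<notin> {- real k..real k}" for k x using that by (simp add: F_def)
  have F1: "integrable lborel (F k)" for k by (rule L2_fun_Icc_integrable[OF F F0])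
  have "L2_norm_sq (\<lambda>t. itrans (F k) t - g t) = L2_norm_sq g - L2_norm_sq (F k)" for k
  proof -
    have "L2_inner (itrans (F k)) g = L2_inner (F k) h"
      using L2_inner_itrans_left[OF F1 g1] by (simp add: h_def[abs_def])
    also have "\<dots> = L2_inner (F k) (F k)"
      unfolding L2_inner_def by (intro Bochner_Integration.integral_cong) (auto simp: F_def indicator_def)
    also have "\<dots> = of_real (L2_norm_sq (F k))" by (rule L2_inner_self)
    finally show ?thesis
      using F F1 g by (simp add: L2_norm_sq_diff L2_fun_itrans Plancherel)
  qed
  moreover have "(\<lambda>k. L2_norm_sq g - L2_norm_sq (F k)) \<longlonglongrightarrow> L2_norm_sq g - L2_norm_sq h"
    by (intro tendsto_intros L2_norm_sq_tendsto F h, unfold F_def, rule L2_truncation[OF h])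
  ultimately have "(\<lambda>k. L2_norm_sq (\<lambda>t. itrans (F k) t - g t)) \<longlonglongrightarrow> 0"
    by (simp add: norm_h)
  then have "\<forall>\<^sub>F k in sequentially. L2_norm_sq (\<lambda>t. itrans (F k) t - g t) < e / 4"
    using e by (intro order_tendstoD(2)) auto
  then obtain k where k: "L2_norm_sq (\<lambda>t. itrans (F k) t - g t) < e / 4"
    by (auto simp: eventually_sequentially)
  have "L2_norm_sq (\<lambda>t. itrans (F k) t - f t) = L2_norm_sq (\<lambda>t. (itrans (F k) t - g t) + (g t - f t))"
    by simp
  also have "\<dots> \<le> 2 * L2_norm_sq (\<lambda>t. itrans (F k) t - g t) + 2 * L2_norm_sq (\<lambda>t. g t - f t)"
    using f g L2_fun_itrans[OF F F1] by (intro L2_norm_sq_add_le) auto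
  also have "\<dots> < e" using K k e unfolding g_def by simp
  finally show thesis using that[OF F F0] by blast
qed

section \<open>Translation operators and the Cauchy kernel\<close>

definition shift_op :: "real \<Rightarrow> complex \<Rightarrow> (real \<Rightarrow> complex) \<Rightarrow> real \<Rightarrow> complex" where
  "shift_op \<beta> z G x = G x - z * G (x + \<beta>)"

text \<open>The product of the operators \<open>shift_op \<beta> (z j)\<close> in expanded form. The
  expansion is visibly symmetric in the factors, so any one of them can be split off, and sorting it
  by \<open>card J\<close> produces \<open>A_coef\<close>.\<close>

definition shift_prod :: "real \<Rightarrow> (nat \<Rightarrow> complex) \<Rightarrow> nat set \<Rightarrow> (real \<Rightarrow> complex) \<Rightarrow> real \<Rightarrow> complex" where
  "shift_prod \<beta> z I G x = (\<Sum>J\<in>Pow I. (-1) ^ card J * (\<Prod>j\<in>J. z j) * G (x + real (card J) * \<beta>))"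

lemma shift_prod_empty [simp]: "shift_prod \<beta> z {} G = G"
  by (rule ext) (simp add: shift_prod_def)

lemma shift_prod_insert:
  assumes "finite I" "k \<notin> I"
  shows "shift_prod \<beta> z (insert k I) G = shift_op \<beta> (z k) (shift_prod \<beta> z I G)"
proof
  fix x
  define h where "h J = (-1) ^ card J * (\<Prod>j\<in>J. z j) * G (x + real (card J) * \<beta>)" for J
  have disj: "Pow I \<inter> insert k ` Pow I = {}" using assms by auto
  have inj: "inj_on (insert k) (Pow I)"
    using assms by (intro inj_onI) (metis Diff_insert_absorb PowD insert_ident subsetD)
  have "sum h (Pow (insert k I)) = sum h (Pow I) + (\<Sum>J\<in>Pow I. h (insert k J))"
    unfolding Pow_insert using assms inj by (subst sum.union_disjoint[OF _ _ disj]) (auto simp: sum.reindex)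
  also have "(\<Sum>J\<in>Pow I. h (insert k J)) = - z k * shift_prod \<beta> z I G (x + \<beta>)"
    unfolding shift_prod_def sum_distrib_left
  proof (rule sum.cong)
    fix J assume "J \<in> Pow I"
    then have "k \<notin> J" "finite J" using assms finite_subset by auto
    then show "h (insert k J) = - z k * ((- 1) ^ card J * prod z J * G (x + \<beta> + real (card J) * \<beta>))"
      by (simp add: h_def distrib_right add_ac)
  qed simp
  finally show "shift_prod \<beta> z (insert k I) G x = shift_op \<beta> (z k) (shift_prod \<beta> z I G) x"
    by (simp add: shift_prod_def shift_op_def h_def)
qed

lemma L2_fun_shift_op:
  assumes "L2_fun G" shows "L2_fun (shift_op \<beta> z G)"
proof -
  have "L2_fun (\<lambda>x. G (x + \<beta>))" using assms by (simp add: L2_fun_shift_iff)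
  then show ?thesis unfolding shift_op_def[abs_def] using assms by (intro L2_fun_diff L2_fun_cmult)
qed

lemma integrable_shift:
  fixes G :: "real \<Rightarrow> complex"
  assumes "integrable lborel G" shows "integrable lborel (\<lambda>x. G (x + \<beta>))"
  using lborel_integrable_real_affine[OF assms, of 1 \<beta>] by (simp add: add.commute)

lemma integrable_shift_op:
  assumes "integrable lborel G" shows "integrable lborel (shift_op \<beta> z G)"
  unfolding shift_op_def[abs_def] using assms integrable_shift[OF assms] by simp

lemma L2_fun_shift_prod: "finite I \<Longrightarrow> L2_fun G \<Longrightarrow> L2_fun (shift_prod \<beta> z I G)"
  by (induction I rule: finite_induct) (simp_all add: shift_prod_insert L2_fun_shift_op)

lemma integrable_shift_prod:
  "finite I \<Longrightarrow> integrable lborel G \<Longrightarrow> integrable lborel (shift_prod \<beta> z I G)"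
  by (induction I rule: finite_induct) (simp_all add: shift_prod_insert integrable_shift_op)

text \<open>Translation is isometric, so the subtracted term has norm \<open>cmod z\<close> times
  that of G, and Cauchy-Schwarz controls the cross term. The lower bound is positive for nonzero
  norm exactly when \<open>cmod z \<noteq> 1\<close>.\<close>

lemma L2_norm_sq_shift_op_bounds:
  assumes G: "L2_fun G"
  shows "(1 - cmod z)\<^sup>2 * L2_norm_sq G \<le> L2_norm_sq (shift_op \<beta> z G)"
    and "L2_norm_sq (shift_op \<beta> z G) \<le> (1 + cmod z)\<^sup>2 * L2_norm_sq G"
proof -
  define H where "H x = z * G (x + \<beta>)" for x
  have T: "L2_fun (\<lambda>x. G (x + \<beta>))" using G by (simp add: L2_fun_shift_iff)
  then have H: "L2_fun H" unfolding H_def[abs_def] by auto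
  have norm_H: "L2_norm_sq H = (cmod z)\<^sup>2 * L2_norm_sq G"
    unfolding H_def[abs_def] by (simp add: L2_norm_sq_cmult L2_norm_sq_shift)
  have "(cmod (L2_inner G H))\<^sup>2 \<le> (cmod z * L2_norm_sq G)\<^sup>2"
    using L2_Cauchy_Schwarz[OF G H] by (simp add: norm_H power2_eq_square ac_simps)
  then have "cmod (L2_inner G H) \<le> cmod z * L2_norm_sq G"
    by (rule power2_le_imp_le) simp
  then have Re: "\<bar>Re (L2_inner G H)\<bar> \<le> cmod z * L2_norm_sq G"
    using abs_Re_le_cmod order_trans by blast
  have eq: "L2_norm_sq (shift_op \<beta> z G) =
      L2_norm_sq G - 2 * Re (L2_inner G H) + (cmod z)\<^sup>2 * L2_norm_sq G"
    unfolding norm_H[symmetric]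
    using L2_norm_sq_diff[OF G H] by (simp add: shift_op_def[abs_def] H_def[abs_def])
  show "(1 - cmod z)\<^sup>2 * L2_norm_sq G \<le> L2_norm_sq (shift_op \<beta> z G)"
    unfolding eq using Re by (simp add: power2_diff algebra_simps)
  show "L2_norm_sq (shift_op \<beta> z G) \<le> (1 + cmod z)\<^sup>2 * L2_norm_sq G"
    unfolding eq using Re by (simp add: power2_sum algebra_simps)
qed

lemma L2_norm_sq_shift_prod_bounds:
  assumes "finite I" "\<And>j. j \<in> I \<Longrightarrow> cmod (z j) \<noteq> 1"
  obtains c C where "c > 0" "C > 0"
    "\<And>G. L2_fun G \<Longrightarrow> c * L2_norm_sq G \<le> L2_norm_sq (shift_prod \<beta> z I G)"
    "\<And>G. L2_fun G \<Longrightarrow> L2_norm_sq (shift_prod \<beta> z I G) \<le> C * L2_norm_sq G"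
proof -
  define c where "c = (\<Prod>j\<in>I. (1 - cmod (z j))\<^sup>2)"
  define C where "C = (\<Prod>j\<in>I. (1 + cmod (z j))\<^sup>2)"
  have "c > 0" unfolding c_def using assms(2) by (intro prod_pos) auto
  moreover have "C > 0" unfolding C_def by (intro prod_pos ballI zero_less_power) (simp add: add_pos_nonneg)
  moreover have "c * L2_norm_sq G \<le> L2_norm_sq (shift_prod \<beta> z I G) \<and>
      L2_norm_sq (shift_prod \<beta> z I G) \<le> C * L2_norm_sq G" if G: "L2_fun G" for G
    using assms(1) unfolding c_def C_def
  proof (induction I rule: finite_induct)
    case (insert k I)
    note b = L2_norm_sq_shift_op_bounds[where z = "z k" and \<beta> = \<beta>,
        OF L2_fun_shift_prod[where z = z and \<beta> = \<beta>, OF insert(1) G]]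
    have "(\<Prod>j\<in>insert k I. (1 - cmod (z j))\<^sup>2) * L2_norm_sq G
        \<le> (1 - cmod (z k))\<^sup>2 * L2_norm_sq (shift_prod \<beta> z I G)"
      using insert by (simp add: mult.assoc mult_left_mono)
    moreover have "(1 + cmod (z k))\<^sup>2 * L2_norm_sq (shift_prod \<beta> z I G)
        \<le> (\<Prod>j\<in>insert k I. (1 + cmod (z j))\<^sup>2) * L2_norm_sq G"
      using insert by (simp add: mult.assoc mult_left_mono)
    ultimately show ?case
      using b insert(1,2) by (simp add: shift_prod_insert)
  qed simp
  ultimately show thesis using that by blast
qed

text \<open>The Neumann series of \<open>1 - zT\<close> need not be summed: its partial sums already show
  that the range is dense.\<close>

lemma shift_op_dense_lt_1:
  assumes F: "L2_fun F" and z: "cmod z < 1" and e: "e > 0"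
  obtains H where "L2_fun H" "L2_norm_sq (\<lambda>x. shift_op \<beta> z H x - F x) < e"
proof -
  define H where "H J x = (\<Sum>j<J. z ^ j * F (x + real j * \<beta>))" for J x
  have shift: "L2_fun (\<lambda>x. F (x + y))" for y using F by (simp add: L2_fun_shift_iff)
  have H: "L2_fun (H J)" for J
    unfolding H_def[abs_def] by (intro L2_fun_sum L2_fun_cmult shift)
  \<comment> \<open>The sum telescopes. As translation is isometric, the remainder has squared norm
    \<open>(cmod z)\<^sup>2 ^ J\<close> times that of F.\<close>
  have "shift_op \<beta> z (H J) x = F x - z ^ J * F (x + real J * \<beta>)" for J x
  proof -
    have "z * H J (x + \<beta>) = (\<Sum>j<J. z ^ Suc j * F (x + real (Suc j) * \<beta>))"
      by (simp add: H_def sum_distrib_left algebra_simps)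
    then have "shift_op \<beta> z (H J) x
        = (\<Sum>j<J. z ^ j * F (x + real j * \<beta>) - z ^ Suc j * F (x + real (Suc j) * \<beta>))"
      by (simp only: shift_op_def sum_subtractf) (simp add: H_def)
    also have "\<dots> = F x - z ^ J * F (x + real J * \<beta>)"
      by (subst sum_lessThan_telescope') simp
    finally show ?thesis .
  qed
  then have "L2_norm_sq (\<lambda>x. shift_op \<beta> z (H J) x - F x) = ((cmod z)\<^sup>2) ^ J * L2_norm_sq F" for J
    using L2_norm_sq_cmult[of "- (z ^ J)" "\<lambda>x. F (x + real J * \<beta>)"]
    by (simp add: L2_norm_sq_shift norm_power power_mult[symmetric] mult.commute)
  moreover have "(\<lambda>J. ((cmod z)\<^sup>2) ^ J * L2_norm_sq F) \<longlonglongrightarrow> 0 * L2_norm_sq F"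
    using z by (intro tendsto_intros LIMSEQ_realpow_zero) (auto simp: power_less_one_iff abs_square_less_1)
  ultimately have "\<forall>\<^sub>F J in sequentially. L2_norm_sq (\<lambda>x. shift_op \<beta> z (H J) x - F x) < e"
    using e by (intro order_tendstoD(2)) auto
  then show thesis using that[OF H] by (auto simp: eventually_sequentially)
qed

text \<open>If \<open>cmod z > 1\<close>, write \<open>1 - z T = - z T (1 - T' / z)\<close> with T'
  the translation by \<open>- \<beta>\<close>. The last factor falls under the previous lemma; the
  isometric T is undone by setting \<open>H = T' K\<close>, and the factor \<open>- z\<close> by
  rescaling the target and the accuracy.\<close>

lemma shift_op_dense:
  assumes F: "L2_fun F" and z: "cmod z \<noteq> 1" and e: "e > 0"
  obtains H where "L2_fun H" "L2_norm_sq (\<lambda>x. shift_op \<beta> z H x - F x) < e"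
proof (cases "cmod z < 1")
  case True
  then show thesis using shift_op_dense_lt_1[OF F _ e] that by blast
next
  case False
  then have z1: "cmod z > 1" using z by simp
  then have z0: "z \<noteq> 0" by auto
  have "cmod (1 / z) < 1" using z1 by (auto simp: norm_divide divide_less_eq)
  moreover have "e / (cmod z)\<^sup>2 > 0" using e z0 by simp
  moreover have "L2_fun (\<lambda>x. - (1 / z) * F x)" using F by (rule L2_fun_cmult)
  ultimately obtain K where K: "L2_fun K"
    and less: "L2_norm_sq (\<lambda>x. shift_op (- \<beta>) (1 / z) K x - (- (1 / z) * F x)) < e / (cmod z)\<^sup>2"
    using shift_op_dense_lt_1[of "\<lambda>x. - (1 / z) * F x" "1 / z" "e / (cmod z)\<^sup>2" "- \<beta>"] by metis
  define H where "H x = K (x + - \<beta>)" for x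
  have H: "L2_fun H" unfolding H_def[abs_def] using K by (simp only: L2_fun_shift_iff)
  have "shift_op \<beta> z H x - F x = - z * (shift_op (- \<beta>) (1 / z) K x - (- (1 / z) * F x))" for x
    using z0 by (simp add: shift_op_def H_def field_simps)
  then have "L2_norm_sq (\<lambda>x. shift_op \<beta> z H x - F x)
      = (cmod z)\<^sup>2 * L2_norm_sq (\<lambda>x. shift_op (- \<beta>) (1 / z) K x - (- (1 / z) * F x))"
    by (simp only: L2_norm_sq_cmult norm_minus_cancel)
  also have "\<dots> < e" using less z0 by (simp add: field_simps)
  finally show thesis using that[OF H] by blast
qed

text \<open>The preimage must also be integrable, since the transform is applied to its image.
  Truncating at the bottom of the induction secures this. The empty product is itself of use: it
  says that integrable functions are dense.\<close>

lemma shift_prod_dense: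
  assumes "finite I" "\<And>j. j \<in> I \<Longrightarrow> cmod (z j) \<noteq> 1" "L2_fun F" "e > 0"
  shows "\<exists>G. L2_fun G \<and> integrable lborel G \<and> L2_norm_sq (\<lambda>x. shift_prod \<beta> z I G x - F x) < e"
  using assms
proof (induction I arbitrary: F e rule: finite_induct)
  case empty
  have "\<forall>\<^sub>F k in sequentially. L2_norm_sq (\<lambda>x. indicator {- real k..real k} x * F x - F x) < e"
    using empty by (intro order_tendstoD(2)[OF L2_truncation]) auto
  then obtain k where k: "L2_norm_sq (\<lambda>x. indicator {- real k..real k} x * F x - F x) < e"
    by (auto simp: eventually_sequentially)
  define G where "G x = indicator {- real k..real k} x * F x" for x
  have G: "L2_fun G" unfolding G_def[abs_def] using empty by auto
  moreover have "integrable lborel G"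
    by (rule L2_fun_Icc_integrable[OF G, of "- real k" "real k"]) (simp add: G_def)
  ultimately show ?case using k unfolding G_def by auto
next
  case (insert k I)
  have "cmod (z k) \<noteq> 1" using insert.prems(1) by simp
  then obtain H where H: "L2_fun H" and H_less: "L2_norm_sq (\<lambda>x. shift_op \<beta> (z k) H x - F x) < e / 4"
    using insert.prems(2,3) shift_op_dense[of F "z k" "e / 4" \<beta>] by auto
  \<comment> \<open>D bounds the outermost factor, so an error below \<open>e / (4 * D)\<close> in
    the approximation of H grows to less than \<open>e / 4\<close>.\<close>
  define D where "D = (1 + cmod (z k))\<^sup>2"
  have D: "D > 0" unfolding D_def by (intro zero_less_power) (simp add: add_pos_nonneg)
  then have "e / (4 * D) > 0" using insert.prems(3) by simp
  then obtain G where G: "L2_fun G" "integrable lborel G"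
    and G_less: "L2_norm_sq (\<lambda>x. shift_prod \<beta> z I G x - H x) < e / (4 * D)"
    using insert.IH[of H "e / (4 * D)"] insert.prems(1) H by auto
  have PG: "L2_fun (shift_prod \<beta> z I G)" using insert.hyps(1) G(1) by (rule L2_fun_shift_prod)
  define X where "X x = shift_prod \<beta> z I G x - H x" for x
  have X: "L2_fun X" unfolding X_def[abs_def] using PG H by auto
  have "L2_norm_sq (\<lambda>x. shift_prod \<beta> z (insert k I) G x - F x)
      = L2_norm_sq (\<lambda>x. shift_op \<beta> (z k) X x + (shift_op \<beta> (z k) H x - F x))"
    using insert.hyps by (simp add: shift_prod_insert shift_op_def X_def algebra_simps)
  also have "\<dots> \<le> 2 * L2_norm_sq (shift_op \<beta> (z k) X) + 2 * L2_norm_sq (\<lambda>x. shift_op \<beta> (z k) H x - F x)"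
    using X H insert.prems by (intro L2_norm_sq_add_le L2_fun_diff L2_fun_shift_op)
  also have "L2_norm_sq (shift_op \<beta> (z k) X) \<le> D * L2_norm_sq X"
    unfolding D_def by (rule L2_norm_sq_shift_op_bounds(2)[OF X])
  also have "D * L2_norm_sq X < e / 4"
    using G_less D unfolding X_def by (simp add: field_simps)
  finally have "L2_norm_sq (\<lambda>x. shift_prod \<beta> z (insert k I) G x - F x) < e"
    using H_less by simp
  then show ?case using G by blast
qed

text \<open>Subsets of the indices other than k are grouped by cardinality. Omitting k leaves at
  most \<open>N - 1\<close> elements, hence the range \<open>s < N\<close>.\<close>

lemma shift_prod_eq_A_coef:
  assumes k: "k \<in> {1..N}"
  shows "shift_prod (1 / \<alpha>) (\<lambda>j. exp (of_real (2 * pi / \<alpha>) * w j)) ({1..N} - {k}) G x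
    = (\<Sum>s<N. A_coef N w \<alpha> k s * G (x + real s / \<alpha>))"
proof -
  define I where "I = {1..N} - {k}"
  have I: "finite I" "card I < N" using k by (auto simp: I_def)
  have card: "card ` Pow I \<subseteq> {..<N}"
    using I by (auto dest: card_mono[OF I(1)])
  define h where "h J = (-1) ^ card J * exp (of_real (2 * pi / \<alpha>) * (\<Sum>j\<in>J. w j)) * G (x + real (card J) / \<alpha>)" for J
  have "shift_prod (1 / \<alpha>) (\<lambda>j. exp (of_real (2 * pi / \<alpha>) * w j)) I G x = sum h (Pow I)"
    unfolding shift_prod_def h_def
  proof (rule sum.cong)
    fix J assume "J \<in> Pow I"
    then have "finite J" using I(1) finite_subset by auto
    then show "(- 1) ^ card J * (\<Prod>j\<in>J. exp (complex_of_real (2 * pi / \<alpha>) * w j)) * G (x + real (card J) * (1 / \<alpha>)) =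
        (- 1) ^ card J * exp (complex_of_real (2 * pi / \<alpha>) * sum w J) * G (x + real (card J) / \<alpha>)"
      by (simp add: exp_sum sum_distrib_left)
  qed simp
  also have "\<dots> = (\<Sum>s<N. \<Sum>J\<in>{J. J \<in> Pow I \<and> card J = s}. h J)"
    using I(1) card by (intro sum.group[symmetric]) auto
  also have "\<dots> = (\<Sum>s<N. A_coef N w \<alpha> k s * G (x + real s / \<alpha>))"
  proof (rule sum.cong)
    fix s
    show "(\<Sum>J\<in>{J. J \<in> Pow I \<and> card J = s}. h J) = A_coef N w \<alpha> k s * G (x + real s / \<alpha>)"
      unfolding A_coef_def I_def[symmetric]
      by (subst sum_distrib_left, subst sum_distrib_right) (rule sum.cong, auto simp: h_def)
  qed simp
  finally show ?thesis unfolding I_def .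
qed

section \<open>The Fourier transform of a simple fraction\<close>

definition cauchy_kernel :: "complex \<Rightarrow> real \<Rightarrow> complex" where
  "cauchy_kernel w x = (if Re w > 0 then indicator {..0} x else - indicator {0..} x)
     * (2 * pi * \<i> * exp (of_real (2 * pi * x) * w))"

text \<open>The modulus is a decaying real exponential, which gives integrability. The complex value
  is then the limit of the integrals over \<open>{0..y}\<close>.\<close>

lemma has_bochner_integral_exp_atLeast:
  assumes "Re c < 0"
  shows "has_bochner_integral lborel (\<lambda>x. indicator {0..} x * exp (of_real x * c)) (- 1 / c)"
proof -
  have "LIM x at_top. Re c * x :> at_bot"
    by (rule filterlim_tendsto_neg_mult_at_bot[OF tendsto_const]) (use assms in \<open>auto intro: filterlim_ident\<close>)
  then have lim: "((\<lambda>x. exp (x * Re c)) \<longlongrightarrow> 0) at_top"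
    by (intro filterlim_compose[OF exp_at_bot]) (simp add: mult.commute)
  have "(\<integral>\<^sup>+x. ennreal (exp (x * Re c)) * indicator {0..} x \<partial>lborel) = ennreal (0 - exp (0 * Re c) / Re c)"
  proof (rule nn_integral_FTC_atLeast)
    show "DERIV (\<lambda>x. exp (x * Re c) / Re c) x :> exp (x * Re c)" for x
      using assms by (auto intro!: derivative_eq_intros)
    show "((\<lambda>x. exp (x * Re c) / Re c) \<longlongrightarrow> 0) at_top"
      using tendsto_divide[OF lim tendsto_const, of "Re c"] assms by simp
  qed auto
  moreover have "(\<integral>\<^sup>+x. ennreal (norm (indicator {0..} x * exp (of_real x * c))) \<partial>lborel)
      = (\<integral>\<^sup>+x. ennreal (exp (x * Re c)) * indicator {0..} x \<partial>lborel)"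
    by (intro nn_integral_cong) (simp add: norm_mult indicator_def)
  ultimately have fin: "(\<integral>\<^sup>+x. ennreal (norm (indicator {0..} x * exp (of_real x * c))) \<partial>lborel) < \<infinity>"
    by simp
  have [measurable]: "(\<lambda>x. exp (complex_of_real x * c)) \<in> borel_measurable borel"
    by (intro borel_measurable_continuous_onI continuous_intros)
  have int: "integrable lborel (\<lambda>x. indicator {0..} x * exp (of_real x * c))"
    by (rule integrableI_bounded[OF _ fin]) measurable
  have c: "c \<noteq> 0" using assms by auto
  define f where "f x = indicator {0..} x * exp (of_real x * c)" for x
  have "((\<lambda>y. LINT x|lborel. indicator {..y} x *\<^sub>R f x) \<longlongrightarrow> (LINT x|lborel. f x)) at_top"
    by (rule tendsto_integral_at_top) (use int in \<open>simp_all add: f_def[abs_def]\<close>)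
  moreover have "\<forall>\<^sub>F y in at_top. (LINT x|lborel. indicator {..y} x *\<^sub>R f x) = (exp (of_real y * c) - 1) / c"
    using eventually_ge_at_top[of 0]
  proof eventually_elim
    case (elim y)
    have "has_bochner_integral lborel (\<lambda>x. indicator {0..y} x *\<^sub>R exp (of_real x * c))
        (exp (of_real y * c) / c - exp (of_real 0 * c) / c)"
    proof (rule has_bochner_integral_FTC_Icc)
      show "((\<lambda>x. exp (of_real x * c) / c) has_vector_derivative exp (of_real x * c)) (at x within {0..y})" for x
        using c by (intro has_vector_derivative_real_field[where f = "\<lambda>z. exp (z * c) / c"])
          (auto intro!: derivative_eq_intros)
    qed (use elim in \<open>auto intro!: continuous_intros\<close>)
    moreover have "(\<lambda>x. indicator {0..y} x *\<^sub>R exp (of_real x * c)) = (\<lambda>x. indicator {..y} x *\<^sub>R f x)"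
      by (auto simp: f_def indicator_def)
    ultimately show ?case
      by (simp add: has_bochner_integral_iff diff_divide_distrib)
  qed
  ultimately have 1: "((\<lambda>y. (exp (of_real y * c) - 1) / c) \<longlongrightarrow> (LINT x|lborel. f x)) at_top"
    by (rule Lim_transform_eventually)
  have "((\<lambda>y. exp (of_real y * c)) \<longlongrightarrow> 0) at_top"
    by (rule tendsto_norm_zero_cancel) (use lim in simp)
  then have 2: "((\<lambda>y. (exp (of_real y * c) - 1) / c) \<longlongrightarrow> (0 - 1) / c) at_top"
    using c by (intro tendsto_intros)
  have "(LINT x|lborel. f x) = (0 - 1) / c"
    by (rule tendsto_unique[OF trivial_limit_at_top_linorder 1 2])
  then show ?thesis using int by (simp add: has_bochner_integral_iff f_def)
qed

lemma has_bochner_integral_reflect: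
  fixes f :: "real \<Rightarrow> complex"
  assumes "has_bochner_integral lborel f v"
  shows "has_bochner_integral lborel (\<lambda>x. f (- x)) v"
  using lborel_has_bochner_integral_real_affine_iff[of "-1" f v 0] assms by simp

lemma has_bochner_integral_exp_atMost:
  assumes "Re c > 0"
  shows "has_bochner_integral lborel (\<lambda>x. indicator {..0} x * exp (of_real x * c)) (1 / c)"
proof -
  have "(\<lambda>x. indicator {0..} (- x) * exp (of_real (- x) * - c)) = (\<lambda>x. indicator {..0::real} x * exp (of_real x * c))"
    by (auto simp: indicator_def)
  then show ?thesis
    using has_bochner_integral_reflect[OF has_bochner_integral_exp_atLeast[of "- c"]] assms by simp
qed

lemma borel_measurable_cauchy_kernel [measurable]: "cauchy_kernel w \<in> borel_measurable borel"
proof -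
  have [measurable]: "(\<lambda>x. exp (complex_of_real (2 * pi * x) * w)) \<in> borel_measurable borel"
    by (intro borel_measurable_continuous_onI continuous_intros)
  show ?thesis unfolding cauchy_kernel_def[abs_def] by measurable
qed

text \<open>The kernel lives on the half-line on which its exponential decays. With
  \<open>c = 2 * pi * (w + \<i> * t)\<close> the half-line integrals are \<open>1 / c\<close> and
  \<open>- 1 / c\<close>, and \<open>2 * pi * \<i> / c = 1 / (t - \<i> * w)\<close>; this explains
  the constant and the sign in \<open>cauchy_kernel\<close>.\<close>

lemma has_bochner_integral_cauchy_kernel:
  assumes w: "Re w \<noteq> 0"
  shows "has_bochner_integral lborel (\<lambda>x. cauchy_kernel w x * ec (x * t)) (1 / (of_real t - \<i> * w))"
proof -
  define c where "c = 2 * pi * (w + \<i> * t)"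
  have exp: "exp (of_real (2 * pi * x) * w) * ec (x * t) = exp (of_real x * c)" for x
    unfolding ec_eq_exp exp_add[symmetric] c_def by (rule arg_cong[of _ _ exp]) (simp add: algebra_simps)
  have nz: "of_real t - \<i> * w \<noteq> 0" "w + \<i> * of_real t \<noteq> 0" using w by (auto simp: complex_eq_iff)
  have val: "2 * pi * \<i> * (1 / c) = 1 / (of_real t - \<i> * w)"
    using nz by (simp add: c_def divide_simps) (simp add: algebra_simps)
  show ?thesis
  proof (cases "Re w > 0")
    case True
    then have "has_bochner_integral lborel (\<lambda>x. 2 * pi * \<i> * (indicator {..0} x * exp (of_real x * c))) (2 * pi * \<i> * (1 / c))"
      by (intro has_bochner_integral_mult_right has_bochner_integral_exp_atMost) (simp add: c_def)
    moreover have "(\<lambda>x. 2 * pi * \<i> * (indicator {..0} x * exp (of_real x * c))) = (\<lambda>x. cauchy_kernel w x * ec (x * t))"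
    proof
      fix x
      have "cauchy_kernel w x * ec (x * t)
          = indicator {..0} x * (2 * pi * \<i> * (exp (of_real (2 * pi * x) * w) * ec (x * t)))"
        by (simp only: cauchy_kernel_def True if_True mult.assoc)
      then show "2 * pi * \<i> * (indicator {..0} x * exp (of_real x * c)) = cauchy_kernel w x * ec (x * t)"
        unfolding exp by (simp only: ac_simps)
    qed
    ultimately show ?thesis unfolding val by simp
  next
    case False
    then have "Re w < 0" using w by simp
    then have "has_bochner_integral lborel (\<lambda>x. - (2 * pi * \<i>) * (indicator {0..} x * exp (of_real x * c))) (- (2 * pi * \<i>) * (- 1 / c))"
      by (intro has_bochner_integral_mult_right has_bochner_integral_exp_atLeast) (simp add: c_def mult_pos_neg)
    moreover have "(\<lambda>x. - (2 * pi * \<i>) * (indicator {0..} x * exp (of_real x * c))) = (\<lambda>x. cauchy_kernel w x * ec (x * t))"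
    proof
      fix x
      have "cauchy_kernel w x * ec (x * t)
          = - (indicator {0..} x * (2 * pi * \<i> * (exp (of_real (2 * pi * x) * w) * ec (x * t))))"
        by (simp only: cauchy_kernel_def False if_False mult.assoc mult_minus_left)
      then show "- (2 * pi * \<i>) * (indicator {0..} x * exp (of_real x * c)) = cauchy_kernel w x * ec (x * t)"
        unfolding exp by (simp only: ac_simps mult_minus_left mult_minus_right)
    qed
    moreover have "- (2 * pi * \<i>) * (- 1 / c) = 1 / (of_real t - \<i> * w)"
      using val by simp
    ultimately show ?thesis by simp
  qed
qed

lemma itrans_cauchy_kernel: "Re w \<noteq> 0 \<Longrightarrow> itrans (cauchy_kernel w) t = 1 / (of_real t - \<i> * w)"
  using has_bochner_integral_cauchy_kernel[of w t] by (simp add: itrans_def has_bochner_integral_iff)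

lemma integrable_cauchy_kernel: "Re w \<noteq> 0 \<Longrightarrow> integrable lborel (cauchy_kernel w)"
  using has_bochner_integral_cauchy_kernel[of w 0] by (simp add: has_bochner_integral_iff)

text \<open>Squaring the modulus doubles the real exponent: the result is, up to the factor
  \<open>2 * pi\<close>, the modulus of another kernel, whose integrability is known.\<close>

lemma L2_fun_cauchy_kernel:
  assumes "Re w \<noteq> 0" shows "L2_fun (cauchy_kernel w)"
proof (rule L2_funI)
  define w' where "w' = 2 * complex_of_real (Re w)"
  have "integrable lborel (\<lambda>x. 2 * pi * cmod (cauchy_kernel w' x))"
    using integrable_cauchy_kernel[of w'] assms by (simp add: w'_def)
  moreover have "(\<lambda>x. 2 * pi * cmod (cauchy_kernel w' x)) = (\<lambda>x. (cmod (cauchy_kernel w x))\<^sup>2)"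
    by (rule ext) (simp add: cauchy_kernel_def w'_def norm_mult power_mult_distrib power2_eq_square
        indicator_def flip: exp_add)
  ultimately show "integrable lborel (\<lambda>x. (cmod (cauchy_kernel w x))\<^sup>2)" by simp
qed simp

text \<open>For either sign of \<open>Re w\<close>, translating the kernel by one period and scaling by \<open>z\<close>
  reproduces it outside that period, so the half-line integrals cancel.\<close>

lemma integral_shift_op_cauchy_kernel:
  fixes m :: int
  assumes H: "L2_fun H" and w: "Re w \<noteq> 0" and \<beta>: "\<beta> > 0"
  shows "(LINT x|lborel. shift_op \<beta> (exp (of_real (2 * pi * \<beta>) * w)) H x * cauchy_kernel w x * ec (- (of_int m * x / \<beta>)))
    = - (2 * pi * \<i>) * L2_inner (\<lambda>x. indicator {0..\<beta>} x * exp (of_real (2 * pi * x) * w) * H x) (trig_char \<beta> m)"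
proof -
  define z where "z = exp (of_real (2 * pi * \<beta>) * w)"
  define E where "E x = ec (- (of_int m * x / \<beta>))" for x
  have [measurable]: "E \<in> borel_measurable borel" unfolding E_def by measurable
  have [measurable]: "H \<in> borel_measurable borel" using H by (rule L2_fun_measurable)
  have expm [measurable]: "(\<lambda>x. exp (complex_of_real (2 * pi * x) * w)) \<in> borel_measurable borel"
    by (intro borel_measurable_continuous_onI continuous_intros)
  \<comment> \<open>The character has period \<beta>, so translations by \<beta> do not affect
    it.\<close>
  have E_shift: "E (x - \<beta>) = E x" for x
  proof -
    have "E (x - \<beta>) = ec (- (of_int m * x / \<beta>) + of_int m)"
      using \<beta> unfolding E_def by (intro arg_cong[of _ _ ec]) (simp add: field_simps)
    then show ?thesis unfolding ec_add by (simp add: E_def)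
  qed
  have KE: "L2_fun (\<lambda>x. E x * cauchy_kernel w (x + b))" for b
    using L2_fun_cauchy_kernel[OF w]
    by (intro L2_fun_mult_bounded[where B = 1]) (simp_all add: L2_fun_shift_iff E_def)
  define a where "a x = H x * (E x * cauchy_kernel w (x + 0))" for x
  define b where "b x = z * (H x * (E x * cauchy_kernel w (x + - \<beta>)))" for x
  have a: "integrable lborel a"
    unfolding a_def[abs_def] by (rule L2_fun_mult_integrable[OF H KE])
  have b: "integrable lborel b"
    unfolding b_def[abs_def] by (intro integrable_mult_right L2_fun_mult_integrable[OF H KE])
  have b': "integrable lborel (\<lambda>x. b (x + \<beta>))" by (rule integrable_shift[OF b])
  \<comment> \<open>The translated half of \<open>shift_op\<close> is written as
    \<open>b (x + \<beta>)\<close>; a substitution then moves the translation from H to the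
    kernel.\<close>
  have "(LINT x|lborel. shift_op \<beta> z H x * cauchy_kernel w x * E x) = (LINT x|lborel. a x - b (x + \<beta>))"
    using E_shift[of "_ + \<beta>"]
    by (intro Bochner_Integration.integral_cong) (simp_all add: shift_op_def a_def b_def algebra_simps)
  also have "\<dots> = (LINT x|lborel. a x) - (LINT x|lborel. b (x + \<beta>))"
    using a b' by (rule Bochner_Integration.integral_diff)
  also have "(LINT x|lborel. b (x + \<beta>)) = (LINT x|lborel. b x)"
    using lborel_integral_real_affine[of 1 b \<beta>] by (simp add: add.commute)
  also have "(LINT x|lborel. a x) - (LINT x|lborel. b x) = (LINT x|lborel. a x - b x)"
    using a b by (rule Bochner_Integration.integral_diff[symmetric])
  also have "\<dots> = (LINT x|lborel. - (2 * pi * \<i>) * (indicator {0..\<beta>} x * exp (of_real (2 * pi * x) * w) * H x * cnj (trig_char \<beta> m x)))"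
  proof (rule integral_cong_AE)
    show "(\<lambda>x. a x - b x) \<in> borel_measurable lborel" using a b by auto
    show "(\<lambda>x. - (2 * pi * \<i>) * (indicator {0..\<beta>} x * exp (of_real (2 * pi * x) * w) * H x * cnj (trig_char \<beta> m x)))
        \<in> borel_measurable lborel" by measurable
    \<comment> \<open>The difference of the two closed half-lines is a half-open interval, open at 0
      or at \<beta> according to the sign of \<open>Re w\<close>. Excluding both points makes it
      agree with \<open>{0..\<beta>}\<close>.\<close>
    have "AE x in lborel. x \<noteq> 0" "AE x in lborel. x \<noteq> \<beta>" by (rule AE_lborel_singleton)+
    then show "AE x in lborel. a x - b x = - (2 * pi * \<i>) * (indicator {0..\<beta>} x * exp (of_real (2 * pi * x) * w) * H x * cnj (trig_char \<beta> m x))"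
    proof eventually_elim
      case (elim x)
      have "of_real (2 * pi * \<beta>) * w + of_real (2 * pi * (x - \<beta>)) * w = of_real (2 * pi * x) * w"
        by (simp add: algebra_simps)
      then have zexp: "z * exp (of_real (2 * pi * (x - \<beta>)) * w) = exp (of_real (2 * pi * x) * w)"
        unfolding z_def exp_add[symmetric] by simp
      have "z * cauchy_kernel w (x - \<beta>) = (if Re w > 0 then indicator {..\<beta>} x else - indicator {\<beta>..} x)
          * (2 * pi * \<i> * exp (of_real (2 * pi * x) * w))"
        unfolding zexp[symmetric] by (simp add: cauchy_kernel_def indicator_def)
      then have kernel: "cauchy_kernel w x - z * cauchy_kernel w (x - \<beta>)
          = - (2 * pi * \<i>) * (indicator {0..\<beta>} x * exp (of_real (2 * pi * x) * w))"
        using elim \<beta> by (auto simp: cauchy_kernel_def indicator_def)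
      have trig: "indicator {0..\<beta>} x * E x = indicator {0..\<beta>} x * cnj (trig_char \<beta> m x)"
        by (simp add: trig_char_def indicator_def cnj_ec E_def)
      have "a x - b x = (cauchy_kernel w x - z * cauchy_kernel w (x - \<beta>)) * (H x * E x)"
        by (simp add: a_def b_def algebra_simps)
      also have "\<dots> = - (2 * pi * \<i>) * (exp (of_real (2 * pi * x) * w) * H x * (indicator {0..\<beta>} x * E x))"
        unfolding kernel by (simp only: ac_simps mult_minus_left mult_minus_right)
      finally show ?case unfolding trig by (simp only: ac_simps)
    qed
  qed
  also have "\<dots> = - (2 * pi * \<i>) * L2_inner (\<lambda>x. indicator {0..\<beta>} x * exp (of_real (2 * pi * x) * w) * H x) (trig_char \<beta> m)"
    unfolding L2_inner_def by (rule integral_mult_right_zero)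
  finally show ?thesis by (simp add: z_def E_def)
qed

section \<open>The frame inequality on the Fourier side\<close>

lemma ennreal_cmod_add_sq_le:
  "ennreal ((cmod (a + b))\<^sup>2) \<le> 2 * ennreal ((cmod a)\<^sup>2) + 2 * ennreal ((cmod b)\<^sup>2)"
proof -
  have "ennreal ((cmod (a + b))\<^sup>2) \<le> ennreal (2 * (cmod a)\<^sup>2 + 2 * (cmod b)\<^sup>2)"
    by (intro ennreal_leI cmod_add_sq_le)
  then show ?thesis by (simp add: ennreal_mult'' ennreal_plus)
qed

text \<open>An element h of D close to f satisfies the lower bound, and the upper bound makes
  \<open>Q\<close> of \<open>h - f\<close> small compared with the norm of f. Q is abstract because
  the lemma serves both \<open>frame_sum\<close> and \<open>fiber_sum\<close>.\<close>

lemma lower_bound_extend_dense: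
  fixes Q :: "(real \<Rightarrow> complex) \<Rightarrow> ennreal"
  assumes add: "\<And>f h. L2_fun f \<Longrightarrow> L2_fun h \<Longrightarrow> Q (\<lambda>x. f x + h x) \<le> 2 * Q f + 2 * Q h"
    and upper: "\<And>f. L2_fun f \<Longrightarrow> Q f \<le> ennreal (B * L2_norm_sq f)" and B: "0 \<le> B"
    and dense: "\<And>f e. L2_fun f \<Longrightarrow> 0 < e \<Longrightarrow> \<exists>h\<in>D. L2_fun h \<and> L2_norm_sq (\<lambda>x. h x - f x) < e"
    and lower: "\<And>h. h \<in> D \<Longrightarrow> ennreal (A * L2_norm_sq h) \<le> Q h" and A: "0 < A"
    and f: "L2_fun f"
  shows "ennreal (A / 8 * L2_norm_sq f) \<le> Q f"
proof (cases "L2_norm_sq f = 0")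
  case False
  define nf where "nf = L2_norm_sq f"
  have nf: "nf > 0" using False L2_norm_sq_nonneg[of f] unfolding nf_def by linarith
  \<comment> \<open>With d the squared distance of h and f, using the factor 2 inequality once for
    the norm and once for Q gives \<open>A * nf \<le> 4 * q + K * d\<close>. Making
    \<open>K * d\<close> at most half of \<open>A * nf\<close> leaves \<open>A / 8\<close>.\<close>
  define K where "K = 4 * B + 2 * A"
  have K: "K > 0" using A B by (simp add: K_def)
  have "A * nf / (2 * K) > 0" using A nf K by simp
  then obtain h where h: "h \<in> D" "L2_fun h" and less: "L2_norm_sq (\<lambda>x. h x - f x) < A * nf / (2 * K)"
    using dense[OF f] by blast
  define d where "d = L2_norm_sq (\<lambda>x. h x - f x)"
  have d: "0 \<le> d" "K * d \<le> A * nf / 2" using less K by (simp_all add: d_def field_simps)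
  have hf: "L2_fun (\<lambda>x. h x - f x)" "L2_fun (\<lambda>x. f x - h x)" using h f by auto
  have "nf \<le> 2 * L2_norm_sq h + 2 * d"
    using L2_norm_sq_add_le[OF h(2) hf(2)] by (simp add: nf_def d_def L2_norm_sq_minus_commute[of f])
  then have 1: "A * nf \<le> 2 * (A * L2_norm_sq h) + 2 * A * d"
    using mult_left_mono[of nf "2 * L2_norm_sq h + 2 * d" A] A by (simp add: algebra_simps)
  show ?thesis
  proof (cases "Q f")
    case (real q)
    have "ennreal (A * L2_norm_sq h) \<le> Q (\<lambda>x. f x + (h x - f x))" using lower[OF h(1)] by simp
    also have "\<dots> \<le> 2 * Q f + 2 * Q (\<lambda>x. h x - f x)" by (rule add[OF f hf(1)])
    also have "\<dots> \<le> 2 * ennreal q + 2 * ennreal (B * d)"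
      using upper[OF hf(1)] real by (intro add_mono mult_left_mono) (auto simp: d_def)
    also have "\<dots> = ennreal (2 * q + 2 * (B * d))"
      using real B d by (simp add: ennreal_mult'' ennreal_plus)
    finally have "A * L2_norm_sq h \<le> 2 * q + 2 * (B * d)"
      using real B d by (subst (asm) ennreal_le_iff) auto
    then have "A * nf \<le> 4 * q + K * d" using 1 by (simp add: K_def algebra_simps)
    then have "A / 8 * nf \<le> q" using d by simp
    then show ?thesis using real by (simp add: nf_def ennreal_leI)
  qed simp
qed simp

section \<open>The window, its atoms and the fibers\<close>

locale rational_window =
  fixes N :: nat and a w :: "nat \<Rightarrow> complex" and \<alpha> :: real
  assumes Re_w: "k \<in> {1..N} \<Longrightarrow> Re (w k) \<noteq> 0" and \<alpha>: "0 < \<alpha>"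
begin

definition z :: "nat \<Rightarrow> complex" where "z k = exp (of_real (2 * pi / \<alpha>) * w k)"

definition g :: "real \<Rightarrow> complex" where "g t = (\<Sum>k=1..N. a k / (of_real t - \<i> * w k))"

definition ghat :: "real \<Rightarrow> complex" where "ghat x = (\<Sum>k=1..N. a k * cauchy_kernel (w k) x)"

lemma norm_z: "k \<in> {1..N} \<Longrightarrow> cmod (z k) \<noteq> 1"
  using Re_w[of k] \<alpha> by (simp add: z_def)

lemma L2_fun_ghat: "L2_fun ghat"
  unfolding ghat_def[abs_def] by (intro L2_fun_sum L2_fun_cmult L2_fun_cauchy_kernel Re_w)

lemma integrable_ghat: "integrable lborel ghat"
  unfolding ghat_def[abs_def]
  by (intro Bochner_Integration.integrable_sum integrable_mult_right integrable_cauchy_kernel Re_w)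

lemma itrans_ghat: "itrans ghat t = g t"
proof -
  have "integrable lborel (\<lambda>x. cauchy_kernel (w k) x * ec (x * t))" if "k \<in> {1..N}" for k
    using Re_w[OF that] by (intro integrable_mult_ec integrable_cauchy_kernel) auto
  then have "(LINT x|lborel. (\<Sum>k=1..N. a k * (cauchy_kernel (w k) x * ec (x * t))))
      = (\<Sum>k=1..N. a k * itrans (cauchy_kernel (w k)) t)"
    unfolding itrans_def by (subst Bochner_Integration.integral_sum) auto
  also have "\<dots> = g t"
    unfolding g_def by (intro sum.cong) (simp_all add: itrans_cauchy_kernel Re_w)
  finally show ?thesis by (simp add: itrans_def ghat_def sum_distrib_right mult.assoc)
qed

text \<open>On this side the time shift by \<open>\<alpha> m\<close> is a modulation and the
  modulation by n a translation. The form \<open>x + - of_int n\<close> matches the translation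
  lemmas, which are stated for \<open>x + c\<close>.\<close>

definition atom_hat :: "int \<Rightarrow> int \<Rightarrow> real \<Rightarrow> complex" where
  "atom_hat m n x = ec (- (\<alpha> * of_int m * (x + - of_int n))) * ghat (x + - of_int n)"

lemma L2_fun_atom_hat: "L2_fun (atom_hat m n)"
  unfolding atom_hat_def[abs_def]
  by (rule L2_fun_mult_bounded[where B = 1]) (simp_all only: L2_fun_shift_iff L2_fun_ghat, auto)

lemma integrable_atom_hat: "integrable lborel (atom_hat m n)"
  unfolding atom_hat_def[abs_def] mult.commute[of "ec _"]
  by (intro integrable_mult_ec integrable_shift integrable_ghat) auto

lemma gabor_atom_eq: "gabor_atom g \<alpha> m n = itrans (atom_hat m n)"
proof
  fix t
  have "itrans (atom_hat m n) t = (LINT x|lborel. atom_hat m n (x + of_int n) * ec ((x + of_int n) * t))"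
    unfolding itrans_def
    using lborel_integral_real_affine[of 1 "\<lambda>x. atom_hat m n x * ec (x * t)" "of_int n"]
    by (simp add: add.commute)
  also have "\<dots> = (LINT x|lborel. ec (of_int n * t) * (ghat x * ec (x * (t - \<alpha> * of_int m))))"
  proof (rule Bochner_Integration.integral_cong)
    fix x
    have "- (\<alpha> * of_int m * x) + (x + of_int n) * t = of_int n * t + x * (t - \<alpha> * of_int m)"
      by (simp add: algebra_simps)
    then have "ec (- (\<alpha> * of_int m * x)) * ec ((x + of_int n) * t) = ec (of_int n * t) * ec (x * (t - \<alpha> * of_int m))"
      by (simp only: flip: ec_add)
    then show "atom_hat m n (x + of_int n) * ec ((x + of_int n) * t)
        = ec (of_int n * t) * (ghat x * ec (x * (t - \<alpha> * of_int m)))"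
      by (simp add: atom_hat_def)
  qed simp
  also have "\<dots> = ec (of_int n * t) * itrans ghat (t - \<alpha> * of_int m)" by (simp add: itrans_def)
  finally show "gabor_atom g \<alpha> m n t = itrans (atom_hat m n) t"
    by (simp add: gabor_atom_def itrans_ghat ec_eq_exp mult.assoc)
qed

lemma L2_fun_gabor_atom: "L2_fun (gabor_atom g \<alpha> m n)"
  unfolding gabor_atom_eq by (intro L2_fun_itrans L2_fun_atom_hat integrable_atom_hat)

abbreviation S :: "(real \<Rightarrow> complex) \<Rightarrow> real \<Rightarrow> complex" where
  "S \<equiv> shift_prod (1 / \<alpha>) z {1..N}"

text \<open>The inner sum of the theorem for a single n, cut to an interval of length
  \<open>1 / \<alpha>\<close> so that \<open>Parseval\<close> applies to it.\<close>

definition fiber :: "(real \<Rightarrow> complex) \<Rightarrow> int \<Rightarrow> real \<Rightarrow> complex" where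
  "fiber G n x = indicator {0..1/\<alpha>} x * (\<Sum>s<N. G (x + of_int n + real s / \<alpha>) * m_fun N a w \<alpha> s x)"

lemma fiber_add: "fiber (\<lambda>x. G x + H x) n x = fiber G n x + fiber H n x"
  by (simp add: fiber_def distrib_left distrib_right sum.distrib)

text \<open>Exchanging the sums over s and k undoes the definition of \<open>m_fun\<close>: each
  exponential is multiplied by the product of all shift factors except its own, which is the shape
  produced by \<open>integral_shift_op_cauchy_kernel\<close>.\<close>

lemma fiber_eq:
  "fiber G n = (\<lambda>x. \<Sum>k=1..N. a k * (indicator {0..1/\<alpha>} x * exp (of_real (2 * pi * x) * w k)
     * shift_prod (1 / \<alpha>) z ({1..N} - {k}) G (x + of_int n)))"
proof
  fix x
  have "(\<Sum>s<N. G (x + of_int n + real s / \<alpha>) * m_fun N a w \<alpha> s x)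
      = (\<Sum>s<N. \<Sum>k=1..N. a k * exp (of_real (2 * pi * x) * w k) * (A_coef N w \<alpha> k s * G (x + of_int n + real s / \<alpha>)))"
    by (simp add: m_fun_def sum_distrib_left ac_simps)
  also have "\<dots> = (\<Sum>k=1..N. a k * exp (of_real (2 * pi * x) * w k)
      * (\<Sum>s<N. A_coef N w \<alpha> k s * G (x + of_int n + real s / \<alpha>)))"
    by (subst sum.swap) (simp add: sum_distrib_left)
  also have "\<dots> = (\<Sum>k=1..N. a k * exp (of_real (2 * pi * x) * w k)
      * shift_prod (1 / \<alpha>) z ({1..N} - {k}) G (x + of_int n))"
    unfolding z_def[abs_def] by (rule sum.cong[OF refl]) (simp only: shift_prod_eq_A_coef)
  finally show "fiber G n x = (\<Sum>k=1..N. a k * (indicator {0..1/\<alpha>} x * exp (of_real (2 * pi * x) * w k)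
     * shift_prod (1 / \<alpha>) z ({1..N} - {k}) G (x + of_int n)))"
    by (simp add: fiber_def sum_distrib_left ac_simps)
qed

lemma L2_fun_fiber_term:
  assumes H: "L2_fun H"
  shows "L2_fun (\<lambda>x. indicator {0..1/\<alpha>} x * exp (of_real (2 * pi * x) * w k) * H x)"
proof (rule L2_fun_mult_bounded[OF H])
  have [measurable]: "(\<lambda>x. exp (complex_of_real (2 * pi * x) * w k)) \<in> borel_measurable borel"
    by (intro borel_measurable_continuous_onI continuous_intros)
  show "(\<lambda>x. indicator {0..1/\<alpha>} x * exp (complex_of_real (2 * pi * x) * w k)) \<in> borel_measurable borel"
    by measurable
  show "cmod (indicator {0..1/\<alpha>} x * exp (complex_of_real (2 * pi * x) * w k))
      \<le> exp (2 * pi / \<alpha> * \<bar>Re (w k)\<bar>)" for x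
  proof (cases "x \<in> {0..1/\<alpha>}")
    case True
    have "x * Re (w k) \<le> x * \<bar>Re (w k)\<bar>" using True by (intro mult_left_mono) auto
    also have "\<dots> \<le> 1 / \<alpha> * \<bar>Re (w k)\<bar>" using True by (intro mult_right_mono) auto
    finally have "2 * pi * (x * Re (w k)) \<le> 2 * pi * (1 / \<alpha> * \<bar>Re (w k)\<bar>)"
      by (intro mult_left_mono) auto
    then show ?thesis using True by (simp add: norm_mult mult.assoc)
  qed simp
qed

lemma L2_fun_shift_prod_shift:
  "L2_fun G \<Longrightarrow> L2_fun (\<lambda>x. shift_prod (1 / \<alpha>) z ({1..N} - {k}) G (x + y))"
  unfolding L2_fun_shift_iff by (rule L2_fun_shift_prod) auto

lemma L2_fun_fiber: "L2_fun G \<Longrightarrow> L2_fun (fiber G n)"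
  unfolding fiber_eq by (intro L2_fun_sum L2_fun_cmult L2_fun_fiber_term L2_fun_shift_prod_shift)

text \<open>\<open>L2_inner\<close> conjugates its second argument. Conjugating \<open>S G\<close>
  as well makes a Gabor coefficient the conjugate of an integral of
  \<open>S G * atom_hat m n\<close>, in which the \<open>w k\<close> appear unconjugated, as they do
  in \<open>m_fun\<close>.\<close>

definition signal :: "(real \<Rightarrow> complex) \<Rightarrow> real \<Rightarrow> complex" where
  "signal G = itrans (\<lambda>x. cnj (S G x))"

lemma S_cnj:
  assumes "L2_fun G" "integrable lborel G"
  shows "L2_fun (\<lambda>x. cnj (S G x))" "integrable lborel (\<lambda>x. cnj (S G x))"
  using assms by (auto intro!: L2_fun_cnj L2_fun_shift_prod integrable_shift_prod)

lemma L2_fun_signal: "L2_fun G \<Longrightarrow> integrable lborel G \<Longrightarrow> L2_fun (signal G)"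
  unfolding signal_def by (intro L2_fun_itrans S_cnj)

lemma L2_norm_sq_signal: "L2_fun G \<Longrightarrow> integrable lborel G \<Longrightarrow> L2_norm_sq (signal G) = L2_norm_sq (S G)"
  unfolding signal_def by (subst Plancherel) (simp_all only: S_cnj L2_norm_sq_cnj)

text \<open>For the k-th summand of the window, the k-th factor of S is split off and absorbed by
  the kernel, leaving an integral of \<open>H k\<close> over one period. Summing over k reassembles
  the fiber. The constant \<open>- (2 * pi * \<i>)\<close> is common to all k and leaves only
  \<open>2 * pi\<close> in the modulus.\<close>

lemma gabor_coefficient:
  assumes G: "L2_fun G" "integrable lborel G"
  shows "cmod (L2_inner (signal G) (gabor_atom g \<alpha> m n)) = 2 * pi * cmod (L2_inner (fiber G n) (trig_char (1 / \<alpha>) m))"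
proof -
  define H where "H k x = shift_prod (1 / \<alpha>) z ({1..N} - {k}) G (x + of_int n)" for k x
  have H: "L2_fun (H k)" for k
    unfolding H_def[abs_def] using G(1) by (rule L2_fun_shift_prod_shift)
  have SG: "S G (x + of_int n) = shift_op (1 / \<alpha>) (z k) (H k) x" if "k \<in> {1..N}" for k x
  proof -
    have "insert k ({1..N} - {k}) = {1..N}" using that by auto
    then have "S G = shift_op (1 / \<alpha>) (z k) (shift_prod (1 / \<alpha>) z ({1..N} - {k}) G)"
      using shift_prod_insert[of "{1..N} - {k}" k "1 / \<alpha>" z G] by simp
    then show ?thesis by (simp add: shift_op_def H_def algebra_simps)
  qed
  have SGn: "L2_fun (\<lambda>x. S G (x + of_int n))"
    unfolding L2_fun_shift_iff using G(1) by (intro L2_fun_shift_prod) auto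
  define E where "E x = ec (- (of_int m * x / (1 / \<alpha>)))" for x
  have int: "integrable lborel (\<lambda>x. S G (x + of_int n) * cauchy_kernel (w k) x * E x)" if "k \<in> {1..N}" for k
    unfolding E_def using L2_fun_cauchy_kernel[OF Re_w[OF that]] SGn
    by (intro integrable_mult_ec L2_fun_mult_integrable) auto
  have "L2_inner (signal G) (gabor_atom g \<alpha> m n) = L2_inner (\<lambda>x. cnj (S G x)) (atom_hat m n)"
    unfolding gabor_atom_eq signal_def
    by (intro Plancherel_inner S_cnj G L2_fun_atom_hat integrable_atom_hat)
  also have "\<dots> = (LINT x|lborel. cnj (S G x * atom_hat m n x))" by (simp add: L2_inner_def)
  also have "\<dots> = cnj (LINT x|lborel. S G x * atom_hat m n x)"
    by (rule Bochner_Integration.integral_cnj)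
  finally have "cmod (L2_inner (signal G) (gabor_atom g \<alpha> m n)) = cmod (LINT x|lborel. S G x * atom_hat m n x)"
    by simp
  \<comment> \<open>Substituting \<open>x + n\<close> moves n from the atom to G; the remaining
    character then depends on m alone and has period \<open>1 / \<alpha>\<close>.\<close>
  also have "(LINT x|lborel. S G x * atom_hat m n x)
      = (LINT x|lborel. S G (x + of_int n) * atom_hat m n (x + of_int n))"
    using lborel_integral_real_affine[of 1 "\<lambda>x. S G x * atom_hat m n x" "of_int n"]
    by (simp add: add.commute)
  also have "\<dots> = (LINT x|lborel. (\<Sum>k=1..N. a k * (S G (x + of_int n) * cauchy_kernel (w k) x * E x)))"
    by (simp add: atom_hat_def ghat_def E_def sum_distrib_left ac_simps)
  also have "\<dots> = (\<Sum>k=1..N. a k * (LINT x|lborel. S G (x + of_int n) * cauchy_kernel (w k) x * E x))"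
    using int by (subst Bochner_Integration.integral_sum) auto
  also have "\<dots> = (\<Sum>k=1..N. a k * (- (2 * pi * \<i>) * L2_inner
      (\<lambda>x. indicator {0..1/\<alpha>} x * exp (of_real (2 * pi * x) * w k) * H k x) (trig_char (1 / \<alpha>) m)))"
  proof (rule sum.cong)
    fix k assume k: "k \<in> {1..N}"
    have "z k = exp (of_real (2 * pi * (1 / \<alpha>)) * w k)" by (simp add: z_def)
    then show "a k * (LINT x|lborel. S G (x + of_int n) * cauchy_kernel (w k) x * E x) =
        a k * (- (2 * pi * \<i>) * L2_inner
      (\<lambda>x. indicator {0..1/\<alpha>} x * exp (of_real (2 * pi * x) * w k) * H k x) (trig_char (1 / \<alpha>) m))"
      using integral_shift_op_cauchy_kernel[OF H[of k] Re_w[OF k], of "1 / \<alpha>" m] \<alpha>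
      by (simp only: SG[OF k] E_def) simp
  qed simp
  also have "\<dots> = - (2 * pi * \<i>) * (\<Sum>k=1..N. L2_inner
      (\<lambda>x. a k * (indicator {0..1/\<alpha>} x * exp (of_real (2 * pi * x) * w k) * H k x)) (trig_char (1 / \<alpha>) m))"
    unfolding L2_inner_cmult_left sum_distrib_left by (intro sum.cong) (simp_all only: ac_simps)
  also have "\<dots> = - (2 * pi * \<i>) * L2_inner (fiber G n) (trig_char (1 / \<alpha>) m)"
  proof -
    have "L2_fun (\<lambda>x. a k * (indicator {0..1/\<alpha>} x * exp (of_real (2 * pi * x) * w k) * H k x))" for k
      by (intro L2_fun_cmult L2_fun_fiber_term H)
    then show ?thesis
      unfolding fiber_eq H_def[symmetric] by (subst L2_inner_sum_left) (rule L2_fun_trig_char refl | assumption)+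
  qed
  finally show ?thesis by (simp add: norm_mult)
qed

definition frame_sum :: "(real \<Rightarrow> complex) \<Rightarrow> ennreal" where
  "frame_sum f = (\<integral>\<^sup>+mn. ennreal ((cmod (L2_inner f (gabor_atom g \<alpha> (fst mn) (snd mn))))\<^sup>2) \<partial>count_space UNIV)"

text \<open>The sum over n stands outside so that each fiber can be treated separately; Tonelli
  restores the order of the theorem in \<open>fiber_sum_eq_integral\<close>.\<close>

definition fiber_sum :: "(real \<Rightarrow> complex) \<Rightarrow> ennreal" where
  "fiber_sum G = (\<integral>\<^sup>+n. (\<integral>\<^sup>+x. ennreal ((cmod (fiber G n x))\<^sup>2) \<partial>lborel) \<partial>count_space UNIV)"

text \<open>For fixed n the sum over m is Parseval for one fiber. The constant combines the square
  of \<open>2 * pi\<close> from \<open>gabor_coefficient\<close> with the period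
  \<open>1 / \<alpha>\<close> from Parseval.\<close>

lemma frame_sum_signal:
  assumes G: "L2_fun G" "integrable lborel G"
  shows "frame_sum (signal G) = ennreal ((2 * pi)\<^sup>2 / \<alpha>) * fiber_sum G"
proof -
  have "frame_sum (signal G) = (\<integral>\<^sup>+n. (\<integral>\<^sup>+m. ennreal ((cmod (L2_inner (signal G) (gabor_atom g \<alpha> m n)))\<^sup>2)
      \<partial>count_space UNIV) \<partial>count_space UNIV)"
    unfolding frame_sum_def by (subst nn_integral_snd_count_space[symmetric]) simp
  also have "\<dots> = (\<integral>\<^sup>+n. ennreal ((2 * pi)\<^sup>2 / \<alpha>) * (\<integral>\<^sup>+x. ennreal ((cmod (fiber G n x))\<^sup>2) \<partial>lborel) \<partial>count_space UNIV)"
  proof (rule nn_integral_cong)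
    fix n
    have "(\<integral>\<^sup>+m. ennreal ((cmod (L2_inner (signal G) (gabor_atom g \<alpha> m n)))\<^sup>2) \<partial>count_space UNIV)
        = (\<integral>\<^sup>+m. ennreal ((2 * pi)\<^sup>2) * ennreal ((cmod (L2_inner (fiber G n) (trig_char (1 / \<alpha>) m)))\<^sup>2) \<partial>count_space UNIV)"
      unfolding gabor_coefficient[OF G] power_mult_distrib[of "2 * pi"]
      by (intro nn_integral_cong ennreal_mult) auto
    also have "\<dots> = ennreal ((2 * pi)\<^sup>2)
        * (\<integral>\<^sup>+m. ennreal ((cmod (L2_inner (fiber G n) (trig_char (1 / \<alpha>) m)))\<^sup>2) \<partial>count_space UNIV)"
      by (rule nn_integral_cmult) simp
    also have "(\<integral>\<^sup>+m. ennreal ((cmod (L2_inner (fiber G n) (trig_char (1 / \<alpha>) m)))\<^sup>2) \<partial>count_space UNIV)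
        = ennreal (1 / \<alpha> * L2_norm_sq (fiber G n))"
      by (rule Parseval[OF _ L2_fun_fiber[OF G(1)]]) (use \<alpha> in \<open>auto simp: fiber_def\<close>)
    also have "ennreal ((2 * pi)\<^sup>2) * ennreal (1 / \<alpha> * L2_norm_sq (fiber G n))
        = ennreal ((2 * pi)\<^sup>2 / \<alpha>) * ennreal (L2_norm_sq (fiber G n))"
      using \<alpha> by (simp flip: ennreal_mult)
    finally show "(\<integral>\<^sup>+m. ennreal ((cmod (L2_inner (signal G) (gabor_atom g \<alpha> m n)))\<^sup>2) \<partial>count_space UNIV)
        = ennreal ((2 * pi)\<^sup>2 / \<alpha>) * (\<integral>\<^sup>+x. ennreal ((cmod (fiber G n x))\<^sup>2) \<partial>lborel)"
      by (simp add: nn_integral_norm_sq_eq L2_fun_fiber[OF G(1)])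
  qed
  also have "\<dots> = ennreal ((2 * pi)\<^sup>2 / \<alpha>) * fiber_sum G"
    unfolding fiber_sum_def by (rule nn_integral_cmult) simp
  finally show ?thesis .
qed

section \<open>Passing from integrable functions to all of L2\<close>

lemma frame_sum_add:
  assumes "L2_fun f" "L2_fun h"
  shows "frame_sum (\<lambda>x. f x + h x) \<le> 2 * frame_sum f + 2 * frame_sum h"
proof -
  let ?c = "\<lambda>f mn. ennreal ((cmod (L2_inner f (gabor_atom g \<alpha> (fst mn) (snd mn))))\<^sup>2)"
  have "frame_sum (\<lambda>x. f x + h x) \<le> (\<integral>\<^sup>+mn. 2 * ?c f mn + 2 * ?c h mn \<partial>count_space UNIV)"
    unfolding frame_sum_def L2_inner_add_left[OF assms L2_fun_gabor_atom]
    by (intro nn_integral_mono ennreal_cmod_add_sq_le)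
  also have "\<dots> = 2 * frame_sum f + 2 * frame_sum h"
    unfolding frame_sum_def by (subst nn_integral_add) (auto simp: nn_integral_cmult)
  finally show ?thesis .
qed

lemma borel_measurable_fiber [measurable]: "L2_fun G \<Longrightarrow> fiber G n \<in> borel_measurable borel"
  by (intro L2_fun_measurable L2_fun_fiber)

lemma fiber_sum_add:
  assumes "L2_fun G" "L2_fun H"
  shows "fiber_sum (\<lambda>x. G x + H x) \<le> 2 * fiber_sum G + 2 * fiber_sum H"
proof -
  have [measurable]: "fiber G n \<in> borel_measurable borel" "fiber H n \<in> borel_measurable borel" for n
    using assms by (auto intro: borel_measurable_fiber)
  let ?c = "\<lambda>G n x. ennreal ((cmod (fiber G n x))\<^sup>2)"
  have "fiber_sum (\<lambda>x. G x + H x) \<le> (\<integral>\<^sup>+n. (\<integral>\<^sup>+x. 2 * ?c G n x + 2 * ?c H n x \<partial>lborel) \<partial>count_space UNIV)"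
    unfolding fiber_sum_def fiber_add by (intro nn_integral_mono ennreal_cmod_add_sq_le)
  also have "\<dots> = (\<integral>\<^sup>+n. 2 * (\<integral>\<^sup>+x. ?c G n x \<partial>lborel) + 2 * (\<integral>\<^sup>+x. ?c H n x \<partial>lborel) \<partial>count_space UNIV)"
    by (simp add: nn_integral_add nn_integral_cmult)
  also have "\<dots> = 2 * fiber_sum G + 2 * fiber_sum H"
    unfolding fiber_sum_def by (subst nn_integral_add) (auto simp: nn_integral_cmult)
  finally show ?thesis .
qed

text \<open>Each finite subsum is continuous in L2 by Cauchy-Schwarz, so the bound passes to the
  limit for it, and the full sum is the supremum of these.\<close>

lemma frame_sum_upper_extend:
  assumes upper: "\<And>G. L2_fun G \<Longrightarrow> integrable lborel G \<Longrightarrow> frame_sum (signal G) \<le> ennreal (B * L2_norm_sq (signal G))"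
    and B: "0 \<le> B"
    and dense: "\<And>f e. L2_fun f \<Longrightarrow> 0 < e \<Longrightarrow>
      \<exists>G. L2_fun G \<and> integrable lborel G \<and> L2_norm_sq (\<lambda>t. signal G t - f t) < e"
    and f: "L2_fun f"
  shows "frame_sum f \<le> ennreal (B * L2_norm_sq f)"
proof -
  define c where "c f mn = (cmod (L2_inner f (gabor_atom g \<alpha> (fst mn) (snd mn))))\<^sup>2" for f mn
  have fin: "(\<Sum>mn\<in>J. ennreal (c f mn)) = ennreal (\<Sum>mn\<in>J. c f mn)" for f J
    by (rule sum_ennreal) (simp add: c_def)
  have frame_eq: "frame_sum f = (SUP J\<in>{J. finite J \<and> J \<subseteq> UNIV}. \<Sum>mn\<in>J. ennreal (c f mn))" for f
  proof -
    have "frame_sum f = (\<Sum>\<^sub>\<infinity>mn\<in>UNIV. ennreal (c f mn))"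
      unfolding frame_sum_def c_def by (rule infsum_ennreal_eq_nn_integral[symmetric]) (simp add: finite_prod)
    then show ?thesis by (simp add: nonneg_infsum_complete)
  qed
  have "\<exists>G. L2_fun G \<and> integrable lborel G \<and> L2_norm_sq (\<lambda>t. signal G t - f t) < 1 / (real k + 1)" for k
    by (rule dense[OF f]) simp
  then obtain G where G: "\<And>k. L2_fun (G k)" "\<And>k. integrable lborel (G k)"
    and less: "\<And>k::nat. L2_norm_sq (\<lambda>t. signal (G k) t - f t) < 1 / (real k + 1)"
    by metis
  have lim: "(\<lambda>k. L2_norm_sq (\<lambda>t. signal (G k) t - f t)) \<longlonglongrightarrow> 0"
  proof (rule tendsto_sandwich[OF _ _ tendsto_const])
    show "\<forall>\<^sub>F k in sequentially. L2_norm_sq (\<lambda>t. signal (G k) t - f t) \<le> 1 / (real k + 1)"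
      using less by (intro always_eventually) (auto intro: less_imp_le)
    show "(\<lambda>k. 1 / (real k + 1)) \<longlonglongrightarrow> 0"
      using LIMSEQ_inverse_real_of_nat by (simp add: inverse_eq_divide add.commute)
  qed auto
  have fG: "L2_fun (signal (G k))" for k by (intro L2_fun_signal G)
  have "(\<Sum>mn\<in>J. c f mn) \<le> B * L2_norm_sq f" if "finite J" for J
  proof (rule LIMSEQ_le)
    show "(\<lambda>k. \<Sum>mn\<in>J. c (signal (G k)) mn) \<longlonglongrightarrow> (\<Sum>mn\<in>J. c f mn)"
      unfolding c_def by (intro tendsto_intros L2_inner_tendsto fG f L2_fun_gabor_atom lim)
    show "(\<lambda>k. B * L2_norm_sq (signal (G k))) \<longlonglongrightarrow> B * L2_norm_sq f"
      by (intro tendsto_intros L2_norm_sq_tendsto fG f lim)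
    have "(\<Sum>mn\<in>J. c (signal (G k)) mn) \<le> B * L2_norm_sq (signal (G k))" for k
    proof -
      have "ennreal (\<Sum>mn\<in>J. c (signal (G k)) mn) \<le> frame_sum (signal (G k))"
        unfolding frame_eq fin[symmetric] using that by (intro SUP_upper) auto
      also have "\<dots> \<le> ennreal (B * L2_norm_sq (signal (G k)))" by (intro upper G)
      finally show ?thesis using B by (subst (asm) ennreal_le_iff) auto
    qed
    then show "\<exists>K. \<forall>k\<ge>K. (\<Sum>mn\<in>J. c (signal (G k)) mn) \<le> B * L2_norm_sq (signal (G k))" by blast
  qed
  then show ?thesis
    unfolding frame_eq fin by (intro SUP_least ennreal_leI) auto
qed

text \<open>Approximate f by some \<open>itrans F\<close>, and the conjugate of F by some
  \<open>S G\<close>. Conjugation and the transform are isometric, so the second error is carried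
  over unchanged.\<close>

lemma signal_dense:
  assumes f: "L2_fun f" and e: "e > 0"
  shows "\<exists>G. L2_fun G \<and> integrable lborel G \<and> L2_norm_sq (\<lambda>t. signal G t - f t) < e"
proof -
  have e4: "e / 4 > 0" using e by simp
  obtain R F where F: "L2_fun F" and F0: "\<And>x. x \<notin> {-R..R} \<Longrightarrow> F x = 0"
    and F_less: "L2_norm_sq (\<lambda>t. itrans F t - f t) < e / 4"
    using itrans_dense[OF f e4] by blast
  have F1: "integrable lborel F" using F F0 by (rule L2_fun_Icc_integrable)
  obtain G where G: "L2_fun G" "integrable lborel G"
    and G_less: "L2_norm_sq (\<lambda>x. S G x - cnj (F x)) < e / 4"
    using shift_prod_dense[of "{1..N}" z "\<lambda>x. cnj (F x)" "e / 4" "1 / \<alpha>"] norm_z e4 F by auto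
  have "L2_norm_sq (\<lambda>t. signal G t - itrans F t) = L2_norm_sq (itrans (\<lambda>x. cnj (S G x) - F x))"
    unfolding signal_def using S_cnj(2)[OF G] F1 by (simp add: itrans_diff)
  also have "\<dots> = L2_norm_sq (\<lambda>x. cnj (S G x) - F x)"
    using S_cnj[OF G] F F1 by (intro Plancherel) auto
  also have "\<dots> = L2_norm_sq (\<lambda>x. S G x - cnj (F x))"
    using L2_norm_sq_cnj[of "\<lambda>x. S G x - cnj (F x)"] by simp
  finally have eq: "L2_norm_sq (\<lambda>t. signal G t - itrans F t) = L2_norm_sq (\<lambda>x. S G x - cnj (F x))" .
  have "L2_norm_sq (\<lambda>t. signal G t - f t) = L2_norm_sq (\<lambda>t. (signal G t - itrans F t) + (itrans F t - f t))" by simp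
  also have "\<dots> \<le> 2 * L2_norm_sq (\<lambda>t. signal G t - itrans F t) + 2 * L2_norm_sq (\<lambda>t. itrans F t - f t)"
    using G F F1 f by (intro L2_norm_sq_add_le L2_fun_diff L2_fun_signal L2_fun_itrans)
  also have "\<dots> < e" using G_less F_less unfolding eq by simp
  finally show ?thesis using G by blast
qed

text \<open>At each point a fiber is a finite combination of values of G, so fibers of truncations
  converge pointwise. Fatou in x and again in n gives the bound.\<close>

lemma fiber_sum_upper_extend:
  assumes upper: "\<And>G. L2_fun G \<Longrightarrow> integrable lborel G \<Longrightarrow> fiber_sum G \<le> ennreal (B * L2_norm_sq G)"
    and B: "0 \<le> B" and G: "L2_fun G"
  shows "fiber_sum G \<le> ennreal (B * L2_norm_sq G)"
proof -
  define Gk where "Gk k x = indicator {- real k..real k} x * G x" for k x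
  have Gk: "L2_fun (Gk k)" for k unfolding Gk_def[abs_def] using G by auto
  have Gk1: "integrable lborel (Gk k)" for k
    by (rule L2_fun_Icc_integrable[where a = "- real k" and b = "real k", OF Gk]) (simp add: Gk_def)
  have [measurable]: "fiber (Gk k) n \<in> borel_measurable borel" for k n
    using Gk by (rule borel_measurable_fiber)
  have "(\<lambda>k. fiber (Gk k) n x) \<longlonglongrightarrow> fiber G n x" for n x
  proof -
    have "(\<lambda>k. Gk k y) \<longlonglongrightarrow> G y" for y
    proof (rule tendsto_eventually)
      obtain K :: nat where K: "\<bar>y\<bar> \<le> real K" using real_arch_simple by blast
      show "\<forall>\<^sub>F k in sequentially. Gk k y = G y"
        using eventually_ge_at_top[of K]
      proof eventually_elim
        case (elim k)
        then have "real K \<le> real k" by simp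
        then have "y \<in> {- real k..real k}" using K by (auto simp: abs_le_iff)
        then show ?case by (simp add: Gk_def)
      qed
    qed
    then show ?thesis unfolding fiber_def by (intro tendsto_intros)
  qed
  then have "(\<lambda>k. ennreal ((cmod (fiber (Gk k) n x))\<^sup>2)) \<longlonglongrightarrow> ennreal ((cmod (fiber G n x))\<^sup>2)" for n x
    by (intro tendsto_ennrealI tendsto_intros)
  then have *: "ennreal ((cmod (fiber G n x))\<^sup>2) = liminf (\<lambda>k. ennreal ((cmod (fiber (Gk k) n x))\<^sup>2))" for n x
    by (intro lim_imp_Liminf[symmetric]) simp_all
  have "fiber_sum G \<le> (\<integral>\<^sup>+n. liminf (\<lambda>k. \<integral>\<^sup>+x. ennreal ((cmod (fiber (Gk k) n x))\<^sup>2) \<partial>lborel) \<partial>count_space UNIV)"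
    unfolding fiber_sum_def * by (intro nn_integral_mono nn_integral_liminf) measurable
  also have "\<dots> \<le> liminf (\<lambda>k. fiber_sum (Gk k))"
    unfolding fiber_sum_def by (rule nn_integral_liminf) simp
  also have "\<dots> \<le> ennreal (B * L2_norm_sq G)"
  proof (rule Liminf_le)
    have "L2_norm_sq (Gk k) \<le> L2_norm_sq G" for k
      unfolding L2_norm_sq_def using G Gk[of k]
      by (intro integral_mono) (auto simp: L2_fun_integrable, simp add: Gk_def indicator_def)
    then have "fiber_sum (Gk k) \<le> ennreal (B * L2_norm_sq G)" for k
      using upper[OF Gk Gk1, of k] B by (meson ennreal_leI mult_left_mono order_trans)
    then show "\<forall>\<^sub>F k in sequentially. fiber_sum (Gk k) \<le> ennreal (B * L2_norm_sq G)" by simp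
  qed simp
  finally show ?thesis .
qed

text \<open>On integrable G the two forms differ by the factor \<kappa>, and the norms of
  \<open>signal G\<close> and G are comparable through p and P. In each direction this transfers the
  bounds on a dense set, and the extension lemmas do the rest, the upper bound going before the
  lower one that relies on it.\<close>

lemma frame_sum_bounds_iff_fiber_sum_bounds:
  "(\<exists>A B. 0 < A \<and> A \<le> B \<and> (\<forall>f. L2_fun f \<longrightarrow>
      ennreal (A * L2_norm_sq f) \<le> frame_sum f \<and> frame_sum f \<le> ennreal (B * L2_norm_sq f)))
    \<longleftrightarrow> (\<exists>c C. 0 < c \<and> c \<le> C \<and> (\<forall>G. L2_fun G \<longrightarrow>
      ennreal (c * L2_norm_sq G) \<le> fiber_sum G \<and> fiber_sum G \<le> ennreal (C * L2_norm_sq G)))"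
proof -
  obtain p P where pP: "p > 0" "P > 0"
    and lo: "\<And>G. L2_fun G \<Longrightarrow> p * L2_norm_sq G \<le> L2_norm_sq (S G)"
    and hi: "\<And>G. L2_fun G \<Longrightarrow> L2_norm_sq (S G) \<le> P * L2_norm_sq G"
    using L2_norm_sq_shift_prod_bounds[of "{1..N}" z] norm_z by (metis finite_atLeastAtMost)
  define \<kappa> where "\<kappa> = (2 * pi)\<^sup>2 / \<alpha>"
  have \<kappa>: "\<kappa> > 0" using \<alpha> by (simp add: \<kappa>_def)
  have key: "frame_sum (signal G) = ennreal \<kappa> * fiber_sum G" if "L2_fun G" "integrable lborel G" for G
    using frame_sum_signal[OF that] by (simp add: \<kappa>_def)
  have key': "fiber_sum G = ennreal (1 / \<kappa>) * frame_sum (signal G)" if "L2_fun G" "integrable lborel G" for G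
  proof -
    have "ennreal (1 / \<kappa>) * frame_sum (signal G) = (ennreal (1 / \<kappa>) * ennreal \<kappa>) * fiber_sum G"
      unfolding key[OF that] by (simp only: mult.assoc)
    also have "ennreal (1 / \<kappa>) * ennreal \<kappa> = 1" using \<kappa> by (simp flip: ennreal_mult)
    finally show ?thesis by simp
  qed
  show ?thesis
  proof
    assume "\<exists>A B. 0 < A \<and> A \<le> B \<and> (\<forall>f. L2_fun f \<longrightarrow>
      ennreal (A * L2_norm_sq f) \<le> frame_sum f \<and> frame_sum f \<le> ennreal (B * L2_norm_sq f))"
    then obtain A B where AB: "0 < A" "A \<le> B"
      and lower: "\<And>f. L2_fun f \<Longrightarrow> ennreal (A * L2_norm_sq f) \<le> frame_sum f"
      and upper: "\<And>f. L2_fun f \<Longrightarrow> frame_sum f \<le> ennreal (B * L2_norm_sq f)"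
      by blast
    \<comment> \<open>The norm of \<open>signal G\<close> is estimated from below by p and from
      above by P, whence the pairing of A with p and of B with P.\<close>
    define c where "c = A * p / \<kappa>"
    define C where "C = B * P / \<kappa>"
    have c: "c > 0" and C: "C \<ge> 0" using AB pP \<kappa> by (simp_all add: c_def C_def)
    have up: "fiber_sum G \<le> ennreal (C * L2_norm_sq G)" if G: "L2_fun G" "integrable lborel G" for G
    proof -
      have "fiber_sum G \<le> ennreal (1 / \<kappa>) * ennreal (B * L2_norm_sq (signal G))"
        unfolding key'[OF G] by (intro mult_left_mono upper L2_fun_signal G) simp
      also have "\<dots> = ennreal (B / \<kappa> * L2_norm_sq (S G))"
        using \<kappa> AB by (simp add: L2_norm_sq_signal[OF G] flip: ennreal_mult)
      also have "\<dots> \<le> ennreal (B / \<kappa> * (P * L2_norm_sq G))"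
        using \<kappa> AB by (intro ennreal_leI mult_left_mono hi G) simp
      finally show ?thesis by (simp add: C_def mult.assoc)
    qed
    have low: "ennreal (c * L2_norm_sq G) \<le> fiber_sum G" if G: "L2_fun G" "integrable lborel G" for G
    proof -
      have "ennreal (c * L2_norm_sq G) = ennreal (A / \<kappa> * (p * L2_norm_sq G))" by (simp add: c_def mult.assoc)
      also have "\<dots> \<le> ennreal (A / \<kappa> * L2_norm_sq (S G))"
        using \<kappa> AB by (intro ennreal_leI mult_left_mono lo G) simp
      also have "\<dots> = ennreal (1 / \<kappa>) * ennreal (A * L2_norm_sq (signal G))"
        using \<kappa> AB by (simp add: L2_norm_sq_signal[OF G] flip: ennreal_mult)
      also have "\<dots> \<le> fiber_sum G"
        unfolding key'[OF G] by (intro mult_left_mono lower L2_fun_signal G) simp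
      finally show ?thesis .
    qed
    have up': "fiber_sum G \<le> ennreal (C * L2_norm_sq G)" if "L2_fun G" for G
      using up C that by (rule fiber_sum_upper_extend)
    have low': "ennreal (c / 8 * L2_norm_sq G) \<le> fiber_sum G" if G: "L2_fun G" for G
    proof (rule lower_bound_extend_dense[OF fiber_sum_add up' C _ _ c G])
      \<comment> \<open>Density of the integrable functions is the case of the empty
        product.\<close>
      show "\<exists>h\<in>{G. L2_fun G \<and> integrable lborel G}. L2_fun h \<and> L2_norm_sq (\<lambda>x. h x - f x) < e"
        if "L2_fun f" "0 < e" for f e
        using shift_prod_dense[of "{}" z f e] that by auto
    qed (use low in auto)
    \<comment> \<open>The constants have to be ordered; enlarging the upper one achieves this
      without comparing C with c.\<close>
    have "c / 8 \<le> max C (c / 8)" by simp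
    moreover have "fiber_sum G \<le> ennreal (max C (c / 8) * L2_norm_sq G)" if "L2_fun G" for G
      using up'[OF that] by (rule order_trans) (intro ennreal_leI mult_right_mono, auto)
    ultimately show "\<exists>c C. 0 < c \<and> c \<le> C \<and> (\<forall>G. L2_fun G \<longrightarrow>
      ennreal (c * L2_norm_sq G) \<le> fiber_sum G \<and> fiber_sum G \<le> ennreal (C * L2_norm_sq G))"
      using c low' by (intro exI[of _ "c / 8"] exI[of _ "max C (c / 8)"]) auto
  next
    assume "\<exists>c C. 0 < c \<and> c \<le> C \<and> (\<forall>G. L2_fun G \<longrightarrow>
      ennreal (c * L2_norm_sq G) \<le> fiber_sum G \<and> fiber_sum G \<le> ennreal (C * L2_norm_sq G))"
    then obtain c C where cC: "0 < c" "c \<le> C"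
      and lower: "\<And>G. L2_fun G \<Longrightarrow> ennreal (c * L2_norm_sq G) \<le> fiber_sum G"
      and upper: "\<And>G. L2_fun G \<Longrightarrow> fiber_sum G \<le> ennreal (C * L2_norm_sq G)"
      by blast
    \<comment> \<open>Here the norm of G is estimated by that of \<open>signal G\<close>, so p and P
      exchange their roles.\<close>
    define A where "A = \<kappa> * c / P"
    define B where "B = \<kappa> * C / p"
    have A: "A > 0" and B: "B \<ge> 0" using cC pP \<kappa> by (simp_all add: A_def B_def)
    have up: "frame_sum (signal G) \<le> ennreal (B * L2_norm_sq (signal G))" if G: "L2_fun G" "integrable lborel G" for G
    proof -
      have "frame_sum (signal G) \<le> ennreal \<kappa> * ennreal (C * L2_norm_sq G)"
        unfolding key[OF G] by (intro mult_left_mono upper G) simp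
      also have "\<dots> = ennreal (B * (p * L2_norm_sq G))"
        using \<kappa> cC pP by (simp add: B_def mult.assoc flip: ennreal_mult)
      also have "\<dots> \<le> ennreal (B * L2_norm_sq (S G))"
        using B by (intro ennreal_leI mult_left_mono lo G)
      finally show ?thesis by (simp add: L2_norm_sq_signal[OF G])
    qed
    have low: "ennreal (A * L2_norm_sq (signal G)) \<le> frame_sum (signal G)" if G: "L2_fun G" "integrable lborel G" for G
    proof -
      have "ennreal (A * L2_norm_sq (signal G)) \<le> ennreal (A * (P * L2_norm_sq G))"
        unfolding L2_norm_sq_signal[OF G] using A by (intro ennreal_leI mult_left_mono hi G) simp
      also have "\<dots> = ennreal \<kappa> * ennreal (c * L2_norm_sq G)"
        using \<kappa> cC pP by (simp add: A_def mult.assoc flip: ennreal_mult)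
      also have "\<dots> \<le> frame_sum (signal G)"
        unfolding key[OF G] by (intro mult_left_mono lower G) simp
      finally show ?thesis .
    qed
    have up': "frame_sum f \<le> ennreal (B * L2_norm_sq f)" if "L2_fun f" for f
      using up B signal_dense that by (rule frame_sum_upper_extend)
    have low': "ennreal (A / 8 * L2_norm_sq f) \<le> frame_sum f" if f: "L2_fun f" for f
    proof (rule lower_bound_extend_dense[OF frame_sum_add up' B _ _ A f])
      show "\<exists>h\<in>{signal G | G. L2_fun G \<and> integrable lborel G}. L2_fun h \<and> L2_norm_sq (\<lambda>x. h x - f x) < e"
        if "L2_fun f" "0 < e" for f e
        using signal_dense[OF that] L2_fun_signal by blast
    qed (use low in auto)
    have "frame_sum f \<le> ennreal (max B (A / 8) * L2_norm_sq f)" if "L2_fun f" for f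
      using up'[OF that] by (rule order_trans) (intro ennreal_leI mult_right_mono, auto)
    then show "\<exists>A B. 0 < A \<and> A \<le> B \<and> (\<forall>f. L2_fun f \<longrightarrow>
      ennreal (A * L2_norm_sq f) \<le> frame_sum f \<and> frame_sum f \<le> ennreal (B * L2_norm_sq f))"
      using A low' by (intro exI[of _ "A / 8"] exI[of _ "max B (A / 8)"]) auto
  qed
qed

lemma gabor_frame_iff_frame_sum:
  "gabor_frame g \<alpha> \<longleftrightarrow> (\<exists>A B. 0 < A \<and> A \<le> B \<and> (\<forall>f. L2_fun f \<longrightarrow>
      ennreal (A * L2_norm_sq f) \<le> frame_sum f \<and> frame_sum f \<le> ennreal (B * L2_norm_sq f)))"
proof -
  have "(\<Sum>\<^sub>\<infinity>mn\<in>(UNIV :: (int \<times> int) set). ennreal ((cmod (L2_inner f (gabor_atom g \<alpha> (fst mn) (snd mn))))\<^sup>2))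
      = frame_sum f" for f
    unfolding frame_sum_def by (rule infsum_ennreal_eq_nn_integral) (simp add: finite_prod)
  then show ?thesis unfolding gabor_frame_def by simp
qed

lemma fiber_sum_eq_integral:
  assumes G: "L2_fun G"
  shows "(\<integral>\<^sup>+\<xi>\<in>{0..1/\<alpha>}. (\<Sum>\<^sub>\<infinity>n\<in>(UNIV :: int set).
      ennreal ((cmod (\<Sum>s<N. G (\<xi> + of_int n + real s / \<alpha>) * m_fun N a w \<alpha> s \<xi>))\<^sup>2)) \<partial>lborel) = fiber_sum G"
proof -
  have [measurable]: "fiber G n \<in> borel_measurable borel" for n using G by (rule borel_measurable_fiber)
  have "(\<Sum>\<^sub>\<infinity>n\<in>(UNIV :: int set).
      ennreal ((cmod (\<Sum>s<N. G (\<xi> + of_int n + real s / \<alpha>) * m_fun N a w \<alpha> s \<xi>))\<^sup>2)) * indicator {0..1/\<alpha>} \<xi>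
      = (\<integral>\<^sup>+n. ennreal ((cmod (fiber G n \<xi>))\<^sup>2) \<partial>count_space UNIV)" for \<xi>
    by (subst infsum_ennreal_eq_nn_integral) (auto simp: fiber_def indicator_def)
  then have "(\<integral>\<^sup>+\<xi>\<in>{0..1/\<alpha>}. (\<Sum>\<^sub>\<infinity>n\<in>(UNIV :: int set).
      ennreal ((cmod (\<Sum>s<N. G (\<xi> + of_int n + real s / \<alpha>) * m_fun N a w \<alpha> s \<xi>))\<^sup>2)) \<partial>lborel)
      = (\<integral>\<^sup>+\<xi>. (\<integral>\<^sup>+n. ennreal ((cmod (fiber G n \<xi>))\<^sup>2) \<partial>count_space UNIV) \<partial>lborel)"
    by simp
  also have "\<dots> = fiber_sum G"
    unfolding fiber_sum_def by (rule nn_integral_count_space_nn_integral) auto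
  finally show ?thesis .
qed

end

theorem theorem2p1:
  fixes N :: nat and a w :: "nat \<Rightarrow> complex" and \<alpha> :: real
  assumes "\<forall>k\<in>{1..N}. a k \<noteq> 0"
    and "\<forall>k\<in>{1..N}. Re (w k) \<noteq> 0"
    and "0 < \<alpha>" and "\<alpha> \<le> 1"
  shows "gabor_frame (\<lambda>t. \<Sum>k=1..N. a k / (of_real t - \<i> * w k)) \<alpha>
    \<longleftrightarrow>
    (\<exists>c C. 0 < c \<and> c \<le> C \<and>
       (\<forall>G. L2_fun G \<longrightarrow>
          ennreal (c * L2_norm_sq G)
            \<le> (\<integral>\<^sup>+\<xi>\<in>{0..1/\<alpha>}. (\<Sum>\<^sub>\<infinity>n\<in>(UNIV :: int set).
                  ennreal ((cmod (\<Sum>s<N. G (\<xi> + of_int n + real s / \<alpha>) * m_fun N a w \<alpha> s \<xi>))\<^sup>2)) \<partial>lborel) \<and>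
          (\<integral>\<^sup>+\<xi>\<in>{0..1/\<alpha>}. (\<Sum>\<^sub>\<infinity>n\<in>(UNIV :: int set).
                  ennreal ((cmod (\<Sum>s<N. G (\<xi> + of_int n + real s / \<alpha>) * m_fun N a w \<alpha> s \<xi>))\<^sup>2)) \<partial>lborel)
            \<le> ennreal (C * L2_norm_sq G)))"
proof -
  interpret rational_window N a w \<alpha> by unfold_locales (use assms in auto)
  have "(\<lambda>t. \<Sum>k=1..N. a k / (of_real t - \<i> * w k)) = g" by (simp add: g_def[abs_def])
  then show ?thesis
    using gabor_frame_iff_frame_sum frame_sum_bounds_iff_fiber_sum_bounds
    by (simp add: fiber_sum_eq_integral cong: conj_cong imp_cong)
qed

end
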